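(* Let $g\in C^1[0,1]$ satisfy $g(0)=0$, $g'(x)\neq0$ for $x\in[0,1]$, and be monotonically increasing with no inflection point in $[0,1]$; put $\sigma_0:=\max_{x\in[0,1]}|g'(x)|$ and $\delta_0:=\min_{x\in[0,1]}|g'(x)|$. Let $f\in L^1[0,1]$ be continuous on $(0,1]$, let $\Psi:=(f/g')\circ g^{-1}$ on $(0,g(1)]$ and $\Theta(y):=\Psi(g(1)y)$, $y\in(0,1]$. If $\Theta$ is of $\mathrm{Type}(\alpha,\infty,\{0\})$ for some $\alpha\in(-1,1)$, then there exists a positive constant $c$ such that for all $\kappa>1$ and all $n\in\mathbb{N}$ satisfying $$\kappa_{\sigma_0}^{1/n}\big(\kappa_{\sigma_0}^{1/n}-1\big)\le (n-1)/e,$$ one has $$\left|\mathcal{I}_\kappa^{\Lambda}[f,g]-\mathcal{Q}_{\kappa,n}^{\Lambda}[f,g]\right|\le c\,|g(1)|^{-\alpha}\,\sigma_0\,\delta_0^{\alpha-2}\,(n-1)^{-1/2}\,\kappa^{-2}\,\kappa_{\sigma_0}\,(\rho_n^0)^n .$$ Moreover, for $n\in\mathbb{N}$, $\mathcal{N}\big(\mathcal{Q}_{\kappa,n}^{\Lambda}[f,g]\big)\le\lceil\sigma_0/\delta_0\rceil\big(2n^2+\lceil1-\alpha\rceil(n^2+n)\big)/2+1$.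
   Context: $\mathbb{N}=\{1,2,\dots\}$. "No inflection point in $[0,1]$" means that $g'$ is monotone on $[0,1]$. Type. A real-valued $\phi\in C^{\infty}((0,1])$ is of $\mathrm{Type}(\alpha,\infty,\{0\})$ if there is a constant $c>0$ with $|\phi^{(k)}(x)|\le c\,x^{\alpha-k}$ for all $x\in(0,1]$ and all $k\in\mathbb{N}$. $\kappa_{\sigma_0}:=\kappa$ if $\sigma_0\le1$ and $\kappa_{\sigma_0}:=\kappa\sigma_0$ if $\sigma_0>1$; $\lambda_0:=\kappa_{\sigma_0}^{-1}$; $\Lambda:=[\lambda_0,1]$; $\rho_n^0:=1-\lambda_0^{1/n}$; $\mathcal{I}_\kappa^{\Lambda}[f,g]:=\int_{\lambda_0}^1f(x)e^{\mathrm{i}\kappa g(x)}\,dx$. Basic Filon-type rule. For $[a,b]\subset(0,1]$ and $m\in\mathbb{N}$, choose (arbitrary) nodes $a=t_0<t_1<\dots<t_m=b$ and let $p_m$ be the polynomial of degree at most $m$ with $p_m(g(t_j))=\Psi(g(t_j))$, $j=0,\dots,m$. Put $\mathcal{Q}^{[a,b]}_{\kappa,m}[f,g]:=\int_{g(a)}^{g(b)}p_m(x)e^{\mathrm{i}\kappa x}\,dx$. For $N\in\mathbb{N}$ let $y_j:=a+(b-a)j/N$, $j=0,\dots,N$, and $\mathcal{Q}^{[a,b]}_{N,\kappa,m}[f,g]:=\sum_{j=1}^{N}\mathcal{Q}^{[y_{j-1},y_j]}_{\kappa,m}[f,g]$. Composite rule on $\Lambda$. Let $x_j:=\kappa_{\sigma_0}^{j/n-1}$,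 $j=0,\dots,n$; for $j=1,\dots,n$ let $M_j:=\max\{|g'(x_{j-1})|,|g'(x_j)|\}$, $q_j:=M_jx_{j-1}/g(x_{j-1})$, $N_j:=\lceil q_j\rceil$, $m_j:=n+\lceil(n+1-j)(1-\alpha)\rceil$. Then $\mathcal{Q}_{\kappa,n}^{\Lambda}[f,g]:=\sum_{j=1}^n\mathcal{Q}^{[x_{j-1},x_j]}_{N_j,\kappa,m_j}[f,g]$. $\mathcal{N}(F)$ denotes the number of evaluations of $\Psi$ used in the formula $F$ (an evaluation at an endpoint shared by two subintervals is counted once). *)

theory Defs
  imports "HOL-Analysis.Analysis" "HOL-Computational_Algebra.Polynomial"
begin

text \<open>
  Smoothness on the half-open interval (0,1] is expressed by a sequence \<open>D\<close> of successive
  derivatives taken within (0,1], hence one-sided at 1; such a sequence is unique on (0,1].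
  The constant \<open>c\<close> does not depend on the order \<open>k\<close>, which ranges over the positive integers.
\<close>

definition type_infinity :: "real \<Rightarrow> (real \<Rightarrow> real) \<Rightarrow> bool" where
  "type_infinity \<alpha> \<phi> \<longleftrightarrow>
     (\<exists>D :: nat \<Rightarrow> real \<Rightarrow> real.
        (\<forall>x\<in>{0<..1}. D 0 x = \<phi> x) \<and>
        (\<forall>k. \<forall>x\<in>{0<..1}. (D k has_real_derivative D (Suc k) x) (at x within {0<..1})) \<and>
        (\<exists>c>0. \<forall>x\<in>{0<..1}. \<forall>k\<ge>1. \<bar>D k x\<bar> \<le> c * x powr (\<alpha> - real k)))"

definition kappa_sigma :: "real \<Rightarrow> real \<Rightarrow> real" where
  "kappa_sigma \<sigma> \<kappa> = (if \<sigma> \<le> 1 then \<kappa> else \<kappa> * \<sigma>)"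

definition lambda0 :: "real \<Rightarrow> real \<Rightarrow> real" where
  "lambda0 \<sigma> \<kappa> = inverse (kappa_sigma \<sigma> \<kappa>)"

definition rho0 :: "real \<Rightarrow> real \<Rightarrow> nat \<Rightarrow> real" where
  "rho0 \<sigma> \<kappa> n = 1 - lambda0 \<sigma> \<kappa> powr (1 / real n)"

definition osc_integral :: "(real \<Rightarrow> real) \<Rightarrow> (real \<Rightarrow> real) \<Rightarrow> real \<Rightarrow> real \<Rightarrow> complex" where
  "osc_integral f g \<sigma> \<kappa> =
     integral {lambda0 \<sigma> \<kappa>..1} (\<lambda>x. complex_of_real (f x) * exp (\<i> * complex_of_real (\<kappa> * g x)))"

definition Psi :: "(real \<Rightarrow> real) \<Rightarrow> (real \<Rightarrow> real) \<Rightarrow> (real \<Rightarrow> real) \<Rightarrow> real \<Rightarrow> real" where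
  "Psi f g g' y = f (the_inv_into {0..1} g y) / g' (the_inv_into {0..1} g y)"

text \<open>
  A choice of nodes assigns to each interval \<open>[a,b]\<close> and each \<open>m\<close> the nodes
  \<open>t a b m 0 < \<dots> < t a b m m\<close>.
\<close>

definition node_choice :: "(real \<Rightarrow> real \<Rightarrow> nat \<Rightarrow> nat \<Rightarrow> real) \<Rightarrow> bool" where
  "node_choice t \<longleftrightarrow>
     (\<forall>a b m. 0 < a \<and> a < b \<and> b \<le> 1 \<and> 1 \<le> m \<longrightarrow>
        t a b m 0 = a \<and> t a b m m = b \<and> (\<forall>j<m. t a b m j < t a b m (Suc j)))"

definition interp_poly :: "(real \<Rightarrow> real) \<Rightarrow> (nat \<Rightarrow> real) \<Rightarrow> nat \<Rightarrow> real poly" where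
  "interp_poly \<psi> z m = (THE p. degree p \<le> m \<and> (\<forall>j\<le>m. poly p (z j) = \<psi> (z j)))"

definition filon ::
  "(real \<Rightarrow> real) \<Rightarrow> (real \<Rightarrow> real) \<Rightarrow> (real \<Rightarrow> real) \<Rightarrow> (real \<Rightarrow> real \<Rightarrow> nat \<Rightarrow> nat \<Rightarrow> real)
     \<Rightarrow> real \<Rightarrow> nat \<Rightarrow> real \<Rightarrow> real \<Rightarrow> complex" where
  "filon f g g' t \<kappa> m a b =
     integral {g a..g b}
       (\<lambda>x. complex_of_real (poly (interp_poly (Psi f g g') (\<lambda>j. g (t a b m j)) m) x)
            * exp (\<i> * complex_of_real (\<kappa> * x)))"

definition subdiv :: "real \<Rightarrow> real \<Rightarrow> nat \<Rightarrow> nat \<Rightarrow> real" where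
  "subdiv a b N j = a + (b - a) * real j / real N"

definition filon_uniform ::
  "(real \<Rightarrow> real) \<Rightarrow> (real \<Rightarrow> real) \<Rightarrow> (real \<Rightarrow> real) \<Rightarrow> (real \<Rightarrow> real \<Rightarrow> nat \<Rightarrow> nat \<Rightarrow> real)
     \<Rightarrow> nat \<Rightarrow> real \<Rightarrow> nat \<Rightarrow> real \<Rightarrow> real \<Rightarrow> complex" where
  "filon_uniform f g g' t N \<kappa> m a b =
     (\<Sum>j=1..N. filon f g g' t \<kappa> m (subdiv a b N (j - 1)) (subdiv a b N j))"

definition mesh :: "real \<Rightarrow> real \<Rightarrow> nat \<Rightarrow> nat \<Rightarrow> real" where
  "mesh \<sigma> \<kappa> n j = kappa_sigma \<sigma> \<kappa> powr (real j / real n - 1)"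

definition slope_max :: "(real \<Rightarrow> real) \<Rightarrow> real \<Rightarrow> real \<Rightarrow> nat \<Rightarrow> nat \<Rightarrow> real" where
  "slope_max g' \<sigma> \<kappa> n j = max \<bar>g' (mesh \<sigma> \<kappa> n (j - 1))\<bar> \<bar>g' (mesh \<sigma> \<kappa> n j)\<bar>"

definition num_sub :: "(real \<Rightarrow> real) \<Rightarrow> (real \<Rightarrow> real) \<Rightarrow> real \<Rightarrow> real \<Rightarrow> nat \<Rightarrow> nat \<Rightarrow> nat" where
  "num_sub g g' \<sigma> \<kappa> n j =
     nat \<lceil>slope_max g' \<sigma> \<kappa> n j * mesh \<sigma> \<kappa> n (j - 1) / g (mesh \<sigma> \<kappa> n (j - 1))\<rceil>"

definition interp_deg :: "real \<Rightarrow> nat \<Rightarrow> nat \<Rightarrow> nat" where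
  "interp_deg \<alpha> n j = n + nat \<lceil>(real n + 1 - real j) * (1 - \<alpha>)\<rceil>"

definition filon_composite ::
  "(real \<Rightarrow> real) \<Rightarrow> (real \<Rightarrow> real) \<Rightarrow> (real \<Rightarrow> real) \<Rightarrow> (real \<Rightarrow> real \<Rightarrow> nat \<Rightarrow> nat \<Rightarrow> real)
     \<Rightarrow> real \<Rightarrow> real \<Rightarrow> real \<Rightarrow> nat \<Rightarrow> complex" where
  "filon_composite f g g' t \<alpha> \<sigma> \<kappa> n =
     (\<Sum>j=1..n. filon_uniform f g g' t (num_sub g g' \<sigma> \<kappa> n j) \<kappa> (interp_deg \<alpha> n j)
                  (mesh \<sigma> \<kappa> n (j - 1)) (mesh \<sigma> \<kappa> n j))"

text \<open>
  The points at which \<open>\<Psi>\<close> is evaluated, for each of the three rules. Being sets, they count an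
  evaluation at an endpoint common to two subintervals only once.
\<close>

definition filon_points ::
  "(real \<Rightarrow> real) \<Rightarrow> (real \<Rightarrow> real \<Rightarrow> nat \<Rightarrow> nat \<Rightarrow> real) \<Rightarrow> nat \<Rightarrow> real \<Rightarrow> real \<Rightarrow> real set" where
  "filon_points g t m a b = (\<lambda>k. g (t a b m k)) ` {0..m}"

definition filon_uniform_points ::
  "(real \<Rightarrow> real) \<Rightarrow> (real \<Rightarrow> real \<Rightarrow> nat \<Rightarrow> nat \<Rightarrow> real)
     \<Rightarrow> nat \<Rightarrow> nat \<Rightarrow> real \<Rightarrow> real \<Rightarrow> real set" where
  "filon_uniform_points g t N m a b =
     (\<Union>j\<in>{1..N}. filon_points g t m (subdiv a b N (j - 1)) (subdiv a b N j))"

definition filon_composite_points ::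
  "(real \<Rightarrow> real) \<Rightarrow> (real \<Rightarrow> real) \<Rightarrow> (real \<Rightarrow> real \<Rightarrow> nat \<Rightarrow> nat \<Rightarrow> real)
     \<Rightarrow> real \<Rightarrow> real \<Rightarrow> real \<Rightarrow> nat \<Rightarrow> real set" where
  "filon_composite_points g g' t \<alpha> \<sigma> \<kappa> n =
     (\<Union>j\<in>{1..n}. filon_uniform_points g t (num_sub g g' \<sigma> \<kappa> n j) (interp_deg \<alpha> n j)
                   (mesh \<sigma> \<kappa> n (j - 1)) (mesh \<sigma> \<kappa> n j))"

definition num_evals ::
  "(real \<Rightarrow> real) \<Rightarrow> (real \<Rightarrow> real) \<Rightarrow> (real \<Rightarrow> real \<Rightarrow> nat \<Rightarrow> nat \<Rightarrow> real)
     \<Rightarrow> real \<Rightarrow> real \<Rightarrow> real \<Rightarrow> nat \<Rightarrow> nat" where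
  "num_evals g g' t \<alpha> \<sigma> \<kappa> n = card (filon_composite_points g g' t \<alpha> \<sigma> \<kappa> n)"

end

theory Submission
  imports Defs
begin

text \<open>
  Put \<open>r = \<kappa>\<^bsub>\<sigma>\<^sub>0\<^esub>\<^sup>1\<^sup>/\<^sup>n\<close>. On a cell \<open>[a,b]\<close> inside \<open>[x\<^bsub>j-1\<^esub>, x\<^sub>j]\<close>, substitute \<open>y = g x\<close>. The
  interpolation error \<open>E = \<Psi> - p\<close> vanishes at both ends, so integrating by parts twice gains
  \<open>\<kappa>\<^sup>-\<^sup>2\<close> and leaves \<open>E'\<close> and \<open>E''\<close>. By Rolle these have \<open>m\<close> and \<open>m - 1\<close> zeros, so Lagrange's
  remainder bounds them by derivatives of \<open>\<Psi>\<close> of order \<open>m + 1\<close>. The number \<open>N\<^sub>j\<close> of cells is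
  chosen so that \<open>g b - g a \<le> (r - 1) g(x\<^bsub>j-1\<^esub>)\<close>, which cancels the singular growth of
  \<open>\<Psi>\<^sup>(\<^sup>m\<^sup>+\<^sup>1\<^sup>)\<close> up to the factor \<open>x\<^bsub>j-1\<^esub> powr (\<alpha> - 1)\<close>, a power of \<open>r\<close>. The extra degree
  \<open>s = m\<^sub>j - n\<close> beats this power, because \<open>(r (r - 1))\<^sup>s \<le> (n - 1)\<^sup>s\<close> while
  \<open>(n + s - 1)! \<ge> (n - 1)! (n - 1)\<^sup>s\<close>. Each of the \<open>n\<close> mesh intervals thus contributes
  \<open>O((r - 1)\<^sup>n / (n - 1)!)\<close>, and \<open>n / (n - 1)!\<close> is \<open>O((n - 1) powr (-1/2))\<close>.
\<close>

subsection \<open>Zeros of higher derivatives and polynomial interpolation\<close>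

text \<open>Rolle's theorem is applied between consecutive zeros of the sorted list; the open gaps
  are disjoint, so the new zeros are distinct. Derivatives are taken within \<open>{u..v}\<close>,
  which at the interior points used agrees with the two-sided derivative.\<close>

lemma Rolle_finite_zeros:
  fixes F F' :: "real \<Rightarrow> real"
  assumes der: "\<And>x. x \<in> {u..v} \<Longrightarrow> (F has_real_derivative F' x) (at x within {u..v})"
    and Z: "finite Z" "Z \<subseteq> {u..v}" "\<And>z. z \<in> Z \<Longrightarrow> F z = 0"
  shows "\<exists>Z'. finite Z' \<and> Z' \<subseteq> {u..v} \<and> card Z' = card Z - 1 \<and> (\<forall>z\<in>Z'. F' z = 0)"
proof -
  define zs where "zs = sorted_list_of_set Z"
  have zs: "set zs = Z" "sorted_wrt (<) zs" "length zs = card Z"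
    using Z(1) by (auto simp: zs_def)
  have "\<exists>w. zs ! i < w \<and> w < zs ! Suc i \<and> F' w = 0" if i: "Suc i < card Z" for i
  proof -
    have less: "zs ! i < zs ! Suc i"
      using zs i by (simp add: sorted_wrt_nth_less)
    have in_Z: "zs ! i \<in> Z" "zs ! Suc i \<in> Z"
      using zs i by (metis nth_mem Suc_lessD)+
    then have sub: "{zs ! i..zs ! Suc i} \<subseteq> {u..v}" using Z(2) by auto
    \<comment> \<open>\<open>Rolle_deriv\<close> speaks of the derivative as a linear map;
      evaluating the zero map at 1 yields \<open>F' w = 0\<close>.\<close>
    have "\<exists>w. zs ! i < w \<and> w < zs ! Suc i \<and> (*) (F' w) = (\<lambda>_. 0)"
    proof (rule Rolle_deriv[OF less])
      show "F (zs ! i) = F (zs ! Suc i)" using Z(3) in_Z by simp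
      show "continuous_on {zs ! i..zs ! Suc i} F"
        by (rule continuous_on_subset[OF DERIV_continuous_on[OF der] sub])
      show "(F has_derivative (*) (F' x)) (at x)" if "zs ! i < x" "x < zs ! Suc i" for x
      proof -
        have "u < x" "x < v" using that sub less by auto
        then have "(F has_real_derivative F' x) (at x)"
          using der[of x] at_within_interior[of x "{u..v}"] by simp
        then show ?thesis by (simp add: has_field_derivative_def)
      qed
    qed
    then show ?thesis by (metis mult_1_right)
  qed
  then obtain w where w: "\<And>i. Suc i < card Z \<Longrightarrow> zs ! i < w i \<and> w i < zs ! Suc i \<and> F' (w i) = 0"
    by metis
  have "w i < w j" if "i < j" "Suc j < card Z" for i j
  proof -
    have "w i < zs ! Suc i" using w[of i] that by simp
    also have "\<dots> \<le> zs ! j"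
      using zs that by (metis Suc_leI Suc_lessD le_neq_implies_less order_refl less_imp_le
          sorted_wrt_nth_less)
    also have "\<dots> < w j" using w[of j] that by simp
    finally show ?thesis .
  qed
  then have inj: "inj_on w {..<card Z - 1}"
    by (intro linorder_inj_onI) (fastforce simp: less_diff_conv)+
  have "w i \<in> {u..v}" if "i < card Z - 1" for i
  proof -
    have "zs ! i \<in> Z" "zs ! Suc i \<in> Z" using zs that
      by (metis Suc_lessD less_diff_conv nth_mem Suc_eq_plus1)+
    then show ?thesis using w[of i] that Z(2) by fastforce
  qed
  then show ?thesis
    using w inj by (intro exI[of _ "w ` {..<card Z - 1}"]) (auto simp: card_image less_diff_conv)
qed

lemma Rolle_finite_zeros_higher:
  fixes F :: "nat \<Rightarrow> real \<Rightarrow> real"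
  assumes der: "\<And>k x. x \<in> {u..v} \<Longrightarrow> (F k has_real_derivative F (Suc k) x) (at x within {u..v})"
    and Z: "finite Z" "Z \<subseteq> {u..v}" "\<And>z. z \<in> Z \<Longrightarrow> F 0 z = 0"
  shows "\<exists>Z'. finite Z' \<and> Z' \<subseteq> {u..v} \<and> card Z' = card Z - k \<and> (\<forall>z\<in>Z'. F k z = 0)"
proof (induction k)
  case 0
  then show ?case using Z by auto
next
  case (Suc k)
  then obtain Z' where "finite Z'" "Z' \<subseteq> {u..v}" "card Z' = card Z - k" "\<forall>z\<in>Z'. F k z = 0"
    by blast
  then show ?case
    using Rolle_finite_zeros[of u v "F k" "F (Suc k)" Z', OF der] by simp
qed

text \<open>Used in two ways: a monic polynomial of degree \<open>m\<close> has \<open>m\<close>-th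
  derivative \<open>fact m\<close>, and the interpolant disappears after one more derivative than
  its degree bound.\<close>

lemma funpow_pderiv_degree_le:
  fixes p :: "real poly"
  assumes "degree p \<le> m"
  shows "(pderiv ^^ m) p = [: fact m * coeff p m :]"
  using assms
proof (induction m arbitrary: p)
  case 0
  then show ?case by (auto elim: degree_eq_zeroE)
next
  case (Suc m)
  have "(pderiv ^^ Suc m) p = (pderiv ^^ m) (pderiv p)" by (simp add: funpow_swap1)
  also have "\<dots> = [: fact m * coeff (pderiv p) m :]"
    using Suc.prems by (intro Suc.IH) (simp add: degree_pderiv)
  finally show ?case by (simp add: coeff_pderiv algebra_simps)
qed

lemma monic_prod_linear:
  fixes Z :: "real set"
  assumes "finite Z"
  shows "degree (\<Prod>z\<in>Z. [:-z, 1:]) = card Z" "coeff (\<Prod>z\<in>Z. [:-z, 1:]) (card Z) = 1"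
proof -
  show "degree (\<Prod>z\<in>Z. [:-z, 1:]) = card Z"
    using assms by (subst degree_prod_eq_sum_degree) auto
  then show "coeff (\<Prod>z\<in>Z. [:-z, 1:]) (card Z) = 1"
    using lead_coeff_prod[of "\<lambda>z. [:-z, 1:]" Z] by simp
qed

text \<open>Lagrange's remainder argument: subtracting a multiple of the nodal polynomial creates
  one further zero at \<open>x\<close>, and Rolle's theorem then ties that multiple to a value of
  \<open>F (card Z)\<close>. An empty \<open>Z\<close> is allowed and gives back the bound
  \<open>B\<close>.\<close>

lemma finite_zeros_bound:
  fixes F :: "nat \<Rightarrow> real \<Rightarrow> real"
  assumes der: "\<And>k x. x \<in> {u..v} \<Longrightarrow> (F k has_real_derivative F (Suc k) x) (at x within {u..v})"
    and Z: "finite Z" "Z \<subseteq> {u..v}" "\<And>z. z \<in> Z \<Longrightarrow> F 0 z = 0"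
    and B: "\<And>x. x \<in> {u..v} \<Longrightarrow> \<bar>F (card Z) x\<bar> \<le> B"
    and x: "x \<in> {u..v}"
  shows "\<bar>F 0 x\<bar> \<le> B * (v - u) ^ card Z / fact (card Z)"
proof (cases "x \<in> Z")
  case True
  have "0 \<le> B" using B[OF x] by linarith
  then show ?thesis using True Z(3) x by simp
next
  case False
  define q where "q = (\<Prod>z\<in>Z. [:-z, 1:])"
  \<comment> \<open>This choice of \<open>c\<close> makes \<open>G 0\<close> vanish at
    \<open>x\<close> as well as on \<open>Z\<close>.\<close>
  define c where "c = F 0 x / poly q x"
  define G where "G k y = F k y - c * poly ((pderiv ^^ k) q) y" for k y
  have poly_q: "poly q y = (\<Prod>z\<in>Z. y - z)" for y by (simp add: q_def poly_prod)
  have qx: "poly q x \<noteq> 0" using False Z(1) by (auto simp: poly_q)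
  have Gder: "(G k has_real_derivative G (Suc k) y) (at y within {u..v})" if "y \<in> {u..v}" for k y
    unfolding G_def using der[OF that]
    by (auto intro!: derivative_eq_intros has_field_derivative_at_within[OF poly_DERIV])
  \<comment> \<open>\<open>G 0\<close> has \<open>card Z + 1\<close> zeros, so one zero survives
    \<open>card Z\<close> differentiations.\<close>
  have "\<exists>Z'. finite Z' \<and> Z' \<subseteq> {u..v} \<and> card Z' = card (insert x Z) - card Z
          \<and> (\<forall>z\<in>Z'. G (card Z) z = 0)"
  proof (rule Rolle_finite_zeros_higher[where F = G, OF Gder])
    show "G 0 z = 0" if "z \<in> insert x Z" for z
      using that Z(1,3) qx by (auto simp: G_def c_def poly_q)
  qed (use Z x in auto)
  then obtain \<xi> where \<xi>: "\<xi> \<in> {u..v}" "G (card Z) \<xi> = 0"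
    using False Z(1) by (auto simp: card_1_singleton_iff)
  have "(pderiv ^^ card Z) q = [: fact (card Z) :]"
    using funpow_pderiv_degree_le[of q "card Z"] monic_prod_linear[OF Z(1)] by (simp add: q_def)
  then have "F (card Z) \<xi> = c * fact (card Z)" using \<xi>(2) by (simp add: G_def)
  then have "\<bar>c\<bar> * fact (card Z) \<le> B" using B[OF \<xi>(1)] by (simp add: abs_mult)
  then have c: "\<bar>c\<bar> \<le> B / fact (card Z)" by (simp add: field_simps)
  have "\<bar>poly q x\<bar> = (\<Prod>z\<in>Z. \<bar>x - z\<bar>)" by (simp add: poly_q abs_prod)
  also have "\<dots> \<le> (\<Prod>z\<in>Z. v - u)" using Z(2) x by (intro prod_mono) (auto simp: abs_le_iff)
  finally have q: "\<bar>poly q x\<bar> \<le> (v - u) ^ card Z" by simp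
  have "\<bar>F 0 x\<bar> = \<bar>c\<bar> * \<bar>poly q x\<bar>" using qx by (simp add: c_def)
  also have "\<dots> \<le> B / fact (card Z) * (v - u) ^ card Z"
    using c q by (intro mult_mono) auto
  finally show ?thesis by simp
qed

text \<open>Newton's construction: the correction for a new node is a multiple of the nodal
  polynomial of the old ones, so the values already attained are kept.\<close>

lemma interpolation_exists:
  fixes z w :: "nat \<Rightarrow> real"
  assumes "inj_on z {..m}"
  shows "\<exists>p. degree p \<le> m \<and> (\<forall>j\<le>m. poly p (z j) = w j)"
  using assms
proof (induction m)
  case 0
  show ?case by (rule exI[of _ "[:w 0:]"]) simp
next
  case (Suc m)
  then obtain p where p: "degree p \<le> m" "\<forall>j\<le>m. poly p (z j) = w j"
    by (meson atMost_subset_iff inj_on_subset le_SucI order_refl)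
  define q where "q = (\<Prod>j\<le>m. [:- z j, 1:])"
  have poly_q: "poly q y = (\<Prod>j\<le>m. y - z j)" for y by (simp add: q_def poly_prod)
  have "z (Suc m) \<noteq> z j" if "j \<le> m" for j
    using inj_onD[OF Suc.prems, of "Suc m" j] that by fastforce
  then have nz: "poly q (z (Suc m)) \<noteq> 0" by (auto simp: poly_q)
  have deg: "degree q = Suc m" unfolding q_def by (subst degree_prod_eq_sum_degree) auto
  define c where "c = (w (Suc m) - poly p (z (Suc m))) / poly q (z (Suc m))"
  have "degree (p + smult c q) \<le> Suc m"
    using p(1) deg by (intro degree_add_le order_trans[OF degree_smult_le]) auto
  moreover have "poly (p + smult c q) (z j) = w j" if "j \<le> Suc m" for j
  proof (cases "j = Suc m")
    case True
    then show ?thesis using nz by (simp add: c_def)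
  next
    case False
    then have "j \<le> m" using that by simp
    then show ?thesis using p(2) by (auto simp: poly_q)
  qed
  ultimately show ?case by blast
qed

text \<open>The description operator in \<open>interp_poly\<close> is meaningful because two
  polynomials of degree at most \<open>m\<close> agreeing at \<open>m + 1\<close> distinct points
  coincide.\<close>

lemma interp_poly_props:
  assumes inj: "inj_on z {..m}"
  shows "degree (interp_poly \<psi> z m) \<le> m" "\<And>j. j \<le> m \<Longrightarrow> poly (interp_poly \<psi> z m) (z j) = \<psi> (z j)"
proof -
  have "\<exists>!p. degree p \<le> m \<and> (\<forall>j\<le>m. poly p (z j) = \<psi> (z j))"
  proof (rule ex_ex1I)
    show "\<exists>p. degree p \<le> m \<and> (\<forall>j\<le>m. poly p (z j) = \<psi> (z j))"
      using interpolation_exists[OF inj, of "\<psi> \<circ> z"] by simp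
  next
    fix p q :: "real poly"
    assume "degree p \<le> m \<and> (\<forall>j\<le>m. poly p (z j) = \<psi> (z j))"
      and "degree q \<le> m \<and> (\<forall>j\<le>m. poly q (z j) = \<psi> (z j))"
    then show "p = q"
      using card_image[OF inj] by (intro poly_eqI_degree[of "z ` {..m}"]) auto
  qed
  from theI'[OF this] show "degree (interp_poly \<psi> z m) \<le> m"
    "\<And>j. j \<le> m \<Longrightarrow> poly (interp_poly \<psi> z m) (z j) = \<psi> (z j)"
    unfolding interp_poly_def by blast+
qed

section \<open>Oscillatory integrals of interpolation errors\<close>

text \<open>
  Integrating by parts twice: \<open>E e\<^sup>i\<^sup>\<kappa>\<^sup>x / (i\<kappa>) + E' e\<^sup>i\<^sup>\<kappa>\<^sup>x / \<kappa>\<^sup>2\<close> has derivative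
  \<open>(E + E'' / \<kappa>\<^sup>2) e\<^sup>i\<^sup>\<kappa>\<^sup>x\<close>.
\<close>

lemma oscillatory_integral_bound:
  fixes E E' E'' :: "real \<Rightarrow> real"
  assumes uv: "u \<le> v" and \<kappa>: "\<kappa> > 0"
    and E: "\<And>x. x \<in> {u..v} \<Longrightarrow> (E has_real_derivative E' x) (at x within {u..v})"
    and E': "\<And>x. x \<in> {u..v} \<Longrightarrow> (E' has_real_derivative E'' x) (at x within {u..v})"
    and E''_cont: "continuous_on {u..v} E''"
    and ends: "E u = 0" "E v = 0"
    and B1: "\<And>x. x \<in> {u..v} \<Longrightarrow> \<bar>E' x\<bar> \<le> B1"
    and B2: "\<And>x. x \<in> {u..v} \<Longrightarrow> \<bar>E'' x\<bar> \<le> B2"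
  shows "cmod (integral {u..v} (\<lambda>x. complex_of_real (E x) * exp (\<i> * complex_of_real (\<kappa> * x))))
          \<le> (2 * B1 + B2 * (v - u)) / \<kappa>\<^sup>2"
proof -
  define e where "e x = exp (\<i> * complex_of_real (\<kappa> * x))" for x
  define H where "H x = complex_of_real (E x) * e x / (\<i> * complex_of_real \<kappa>)
                      + complex_of_real (E' x) * e x / (complex_of_real \<kappa>)\<^sup>2" for x
  have ne: "cmod (e x) = 1" for x by (simp add: e_def norm_exp_eq_Re)
  have e_cont: "continuous_on {u..v} e" unfolding e_def by (intro continuous_intros)
  have e_der: "(e has_vector_derivative \<i> * complex_of_real \<kappa> * e x) (at x within {u..v})" for x
  proof -
    have "((\<lambda>z. exp (\<i> * (complex_of_real \<kappa> * z))) has_field_derivative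
            \<i> * complex_of_real \<kappa> * e x) (at (complex_of_real x))"
      unfolding e_def by (auto intro!: derivative_eq_intros)
    from has_vector_derivative_real_field[OF this] show ?thesis
      unfolding e_def by (simp add: o_def)
  qed
  have cmplx: "((\<lambda>x. complex_of_real (h x)) has_vector_derivative complex_of_real h') (at x within S)"
    if "(h has_real_derivative h') (at x within S)" for h :: "real \<Rightarrow> real" and h' x S
    using has_vector_derivative_of_real[of h h' "at x within S"] that
    by (simp add: has_real_derivative_iff_has_vector_derivative)
  have H_der: "(H has_vector_derivative
          (complex_of_real (E x) * e x + complex_of_real (E'' x) * e x / (complex_of_real \<kappa>)\<^sup>2))
          (at x within {u..v})" if x: "x \<in> {u..v}" for x
  proof -
    have "(H has_vector_derivative
        ((complex_of_real (E x) * (\<i> * complex_of_real \<kappa> * e x) + complex_of_real (E' x) * e x)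
            / (\<i> * complex_of_real \<kappa>)
          + (complex_of_real (E' x) * (\<i> * complex_of_real \<kappa> * e x) + complex_of_real (E'' x) * e x)
            / (complex_of_real \<kappa>)\<^sup>2)) (at x within {u..v})"
      unfolding H_def
      by (intro has_vector_derivative_add has_vector_derivative_divide has_vector_derivative_mult
          cmplx E[OF x] E'[OF x] e_der)
    \<comment> \<open>The two terms containing \<open>E'\<close> cancel, since
      \<open>\<i> / \<kappa> = - 1 / (\<i> * \<kappa>)\<close>.\<close>
    then show ?thesis
      by (rule back_subst[where P = "\<lambda>d. (H has_vector_derivative d) (at x within {u..v})"])
        (use \<kappa> in \<open>simp add: field_simps power2_eq_square\<close>)
  qed
  have E_cont: "continuous_on {u..v} E" by (rule DERIV_continuous_on[OF E])
  have int1: "(\<lambda>x. complex_of_real (E x) * e x) integrable_on {u..v}"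
    by (intro integrable_continuous_real continuous_intros E_cont e_cont)
  have int2: "(\<lambda>x. complex_of_real (E'' x) * e x) integrable_on {u..v}"
    by (intro integrable_continuous_real continuous_intros E''_cont e_cont)
  have "integral {u..v} (\<lambda>x. complex_of_real (E x) * e x
          + complex_of_real (E'' x) * e x / (complex_of_real \<kappa>)\<^sup>2) = H v - H u"
    using fundamental_theorem_of_calculus[OF uv H_der] by (rule integral_unique)
  then have "integral {u..v} (\<lambda>x. complex_of_real (E x) * e x) =
      H v - H u - integral {u..v} (\<lambda>x. complex_of_real (E'' x) * e x) / (complex_of_real \<kappa>)\<^sup>2"
    using int1 int2 by (simp add: integral_add integrable_on_divide eq_diff_eq)
  \<comment> \<open>The boundary terms of order \<open>1 / \<kappa>\<close> contain \<open>E\<close>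
    and vanish at both ends; everything left carries \<open>1 / \<kappa>\<^sup>2\<close>.\<close>
  also have "\<dots> = (complex_of_real (E' v) * e v - complex_of_real (E' u) * e u
      - integral {u..v} (\<lambda>x. complex_of_real (E'' x) * e x)) / (complex_of_real \<kappa>)\<^sup>2"
    by (simp add: H_def ends diff_divide_distrib)
  finally have eq: "cmod (integral {u..v} (\<lambda>x. complex_of_real (E x) * e x)) =
      cmod (complex_of_real (E' v) * e v - complex_of_real (E' u) * e u
      - integral {u..v} (\<lambda>x. complex_of_real (E'' x) * e x)) / \<kappa>\<^sup>2"
    by (simp add: norm_divide norm_power)
  have I2: "cmod (integral {u..v} (\<lambda>x. complex_of_real (E'' x) * e x)) \<le> B2 * (v - u)"
    using B2 by (intro integral_bound uv continuous_intros E''_cont e_cont) (auto simp: norm_mult ne)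
  have "cmod (complex_of_real (E' v) * e v) \<le> B1" "cmod (complex_of_real (E' u) * e u) \<le> B1"
    using B1 uv by (auto simp: norm_mult ne)
  then have "cmod (complex_of_real (E' v) * e v - complex_of_real (E' u) * e u
      - integral {u..v} (\<lambda>x. complex_of_real (E'' x) * e x)) \<le> B1 + B1 + B2 * (v - u)"
    using I2 by (intro order_trans[OF norm_triangle_ineq4] add_mono) auto
  then show ?thesis
    using \<kappa> unfolding eq e_def[symmetric] by (simp add: divide_right_mono)
qed

lemma interpolation_integral_error:
  fixes D :: "nat \<Rightarrow> real \<Rightarrow> real"
  assumes der: "\<And>k x. x \<in> {u..v} \<Longrightarrow> (D k has_real_derivative D (Suc k) x) (at x within {u..v})"
    and \<kappa>: "\<kappa> > 0" and m: "m \<ge> 1"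
    and z: "z 0 = u" "z m = v" "strict_mono_on {..m} z"
    and B: "\<And>x. x \<in> {u..v} \<Longrightarrow> \<bar>D (Suc m) x\<bar> \<le> B"
    and \<psi>: "\<And>x. x \<in> {u..v} \<Longrightarrow> \<psi> x = D 0 x"
  shows "cmod (integral {u..v} (\<lambda>x. complex_of_real (\<psi> x) * exp (\<i> * complex_of_real (\<kappa> * x)))
            - integral {u..v} (\<lambda>x. complex_of_real (poly (interp_poly \<psi> z m) x)
                * exp (\<i> * complex_of_real (\<kappa> * x))))
          \<le> 3 * B * (v - u) ^ m / fact (m - 1) / \<kappa>\<^sup>2"
proof -
  have inj: "inj_on z {..m}" using z(3) by (rule strict_mono_on_imp_inj_on)
  define p where "p = interp_poly \<psi> z m"
  note p = interp_poly_props[OF inj, where \<psi> = \<psi>, folded p_def]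
  define F where "F k x = D k x - poly ((pderiv ^^ k) p) x" for k x
  have Fder: "(F k has_real_derivative F (Suc k) y) (at y within {u..v})" if "y \<in> {u..v}" for k y
    unfolding F_def using der[OF that]
    by (auto intro!: derivative_eq_intros has_field_derivative_at_within[OF poly_DERIV])
  have uv: "u < v" using z m strict_mono_onD[OF z(3), of 0 m] by simp
  have zin: "z j \<in> {u..v}" if "j \<le> m" for j
    using z that strict_mono_on_leD[OF z(3), of 0 j] strict_mono_on_leD[OF z(3), of j m] by simp
  have Z: "finite (z ` {..m})" "z ` {..m} \<subseteq> {u..v}" "\<And>y. y \<in> z ` {..m} \<Longrightarrow> F 0 y = 0"
    using zin p(2) \<psi> by (auto simp: F_def)
  have cardZ: "card (z ` {..m}) = Suc m" using card_image[OF inj] by simp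
  \<comment> \<open>Hence \<open>F (Suc m)\<close> equals \<open>D (Suc m)\<close>, and the bound
    \<open>B\<close> carries over to the error.\<close>
  have "(pderiv ^^ Suc m) p = 0"
    using funpow_pderiv_degree_le[of p m] p(1) by simp
  then have FB: "\<bar>F (Suc m) x\<bar> \<le> B" if "x \<in> {u..v}" for x
    using B[OF that] by (simp add: F_def)
  obtain Z1 where Z1: "finite Z1" "Z1 \<subseteq> {u..v}" "card Z1 = m" "\<forall>z\<in>Z1. F (Suc 0) z = 0"
    using Rolle_finite_zeros_higher[where F = F and k = 1, OF Fder Z] cardZ by auto
  \<comment> \<open>For \<open>m = 1\<close> this set is empty, and the bound on the second
    derivative below is just \<open>B\<close>.\<close>
  obtain Z2 where Z2: "finite Z2" "Z2 \<subseteq> {u..v}" "card Z2 = m - 1" "\<forall>z\<in>Z2. F (Suc (Suc 0)) z = 0"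
    using Rolle_finite_zeros_higher[where F = F and k = "Suc (Suc 0)", OF Fder Z] cardZ by auto
  have F1: "\<bar>F (Suc 0) x\<bar> \<le> B * (v - u) ^ m / fact m" if "x \<in> {u..v}" for x
    using finite_zeros_bound[of u v "\<lambda>k. F (Suc k)" Z1 B x] Fder Z1 FB that by simp
  have F2: "\<bar>F (Suc (Suc 0)) x\<bar> \<le> B * (v - u) ^ (m - 1) / fact (m - 1)" if "x \<in> {u..v}" for x
    using finite_zeros_bound[of u v "\<lambda>k. F (Suc (Suc k))" Z2 B x] Fder Z2 FB that m by simp
  have B0: "B \<ge> 0" using FB[of u] uv by fastforce
  have cont: "continuous_on {u..v} (F k)" for k by (rule DERIV_continuous_on[OF Fder])
  have contD: "continuous_on {u..v} (D 0)" by (rule DERIV_continuous_on[OF der])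
  have cont\<psi>: "continuous_on {u..v} \<psi>"
    by (rule continuous_on_eq[OF contD]) (simp add: \<psi>)
  have "integral {u..v} (\<lambda>x. complex_of_real (\<psi> x) * exp (\<i> * complex_of_real (\<kappa> * x)))
        - integral {u..v} (\<lambda>x. complex_of_real (poly p x) * exp (\<i> * complex_of_real (\<kappa> * x)))
      = integral {u..v} (\<lambda>x. complex_of_real (\<psi> x) * exp (\<i> * complex_of_real (\<kappa> * x))
          - complex_of_real (poly p x) * exp (\<i> * complex_of_real (\<kappa> * x)))"
    by (intro integral_diff[symmetric] integrable_continuous_real continuous_intros cont\<psi>)
  also have "\<dots> = integral {u..v} (\<lambda>x. complex_of_real (F 0 x) * exp (\<i> * complex_of_real (\<kappa> * x)))"
    using \<psi> by (intro integral_cong) (simp add: F_def algebra_simps)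
  also have "cmod \<dots> \<le> (2 * (B * (v - u) ^ m / fact m)
      + B * (v - u) ^ (m - 1) / fact (m - 1) * (v - u)) / \<kappa>\<^sup>2"
  proof (rule oscillatory_integral_bound)
    show "F 0 u = 0" "F 0 v = 0" using Z(3)[of u] Z(3)[of v] z(1,2) by auto
  qed (use uv \<kappa> in \<open>auto intro: Fder cont F1 F2[unfolded One_nat_def]\<close>)
  \<comment> \<open>Weakening \<open>fact m\<close> to \<open>fact (m - 1)\<close> gives both terms
    the same shape, whence the constant 3 = 2 + 1.\<close>
  also have "\<dots> \<le> (2 * (B * (v - u) ^ m / fact (m - 1)) + B * (v - u) ^ m / fact (m - 1)) / \<kappa>\<^sup>2"
  proof (intro divide_right_mono add_mono mult_left_mono)
    show "B * (v - u) ^ m / fact m \<le> B * (v - u) ^ m / fact (m - 1)"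
      using B0 uv by (intro divide_left_mono fact_mono) auto
    show "B * (v - u) ^ (m - 1) / fact (m - 1) * (v - u) \<le> B * (v - u) ^ m / fact (m - 1)"
      using m by (cases m) (auto simp: mult.assoc mult.commute[of "v - u"])
  qed auto
  also have "\<dots> = 3 * B * (v - u) ^ m / fact (m - 1) / \<kappa>\<^sup>2" by simp
  finally show ?thesis unfolding p_def .
qed

lemma integral_split_sum:
  fixes h :: "real \<Rightarrow> complex" and y :: "nat \<Rightarrow> real"
  assumes "\<And>j. j < N \<Longrightarrow> y j \<le> y (Suc j)" "h integrable_on {y 0..y N}"
  shows "integral {y 0..y N} h = (\<Sum>j=1..N. integral {y (j - 1)..y j} h)"
  using assms
proof (induction N)
  case (Suc N)
  have "y 0 \<le> y N" using lift_Suc_mono_le_ivl[of "{..<Suc N}" y 0 N] Suc.prems(1) by (simp add: subset_eq)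
  moreover have "y N \<le> y (Suc N)" using Suc.prems(1) by simp
  moreover from calculation have "h integrable_on {y 0..y N}"
    using Suc.prems(2) by (auto intro: integrable_subinterval_real)
  ultimately show ?case
    using Henstock_Kurzweil_Integration.integral_combine[of "y 0" "y N" "y (Suc N)" h] Suc by simp
qed simp

subsection \<open>Mesh, nodes and evaluation points\<close>

text \<open>Passes from \<Theta> to \<Psi> with \<open>L = g 1\<close>. The chain rule contributes
  \<open>L ^ k\<close> in the denominator, and the power of \<open>x / L\<close> contributes the
  same factor in the numerator, so only \<open>L powr (- \<alpha>)\<close> remains and the constant
  stays uniform in \<open>k\<close>.\<close>

lemma type_infinity_rescale:
  assumes "type_infinity \<alpha> (\<lambda>y. \<Phi> (L * y))" and L: "L > 0"
  obtains D C where "C > 0"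
    and "\<And>x. x \<in> {0<..L} \<Longrightarrow> D 0 x = \<Phi> x"
    and "\<And>k x. x \<in> {0<..L} \<Longrightarrow> (D k has_real_derivative D (Suc k) x) (at x within {0<..L})"
    and "\<And>k x. x \<in> {0<..L} \<Longrightarrow> k \<ge> 1 \<Longrightarrow> \<bar>D k x\<bar> \<le> C * x powr (\<alpha> - real k)"
proof -
  obtain D c where D0: "\<And>x. x \<in> {0<..1} \<Longrightarrow> D 0 x = \<Phi> (L * x)"
    and Dder: "\<And>k x. x \<in> {0<..1} \<Longrightarrow> (D k has_real_derivative D (Suc k) x) (at x within {0<..1})"
    and c: "c > 0" "\<And>x k. x \<in> {0<..1} \<Longrightarrow> k \<ge> 1 \<Longrightarrow> \<bar>D k x\<bar> \<le> c * x powr (\<alpha> - real k)"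
    using assms(1) unfolding type_infinity_def by metis
  have scale: "x / L \<in> {0<..1}" if "x \<in> {0<..L}" for x using that L by (simp add: field_simps)
  show ?thesis
  proof (rule that[of "c * L powr (- \<alpha>)" "\<lambda>k x. D k (x / L) / L ^ k"])
    show "c * L powr (- \<alpha>) > 0" using c L by simp
    show "D 0 (x / L) / L ^ 0 = \<Phi> x" if "x \<in> {0<..L}" for x using D0[OF scale[OF that]] L by simp
    show "((\<lambda>x. D k (x / L) / L ^ k) has_real_derivative D (Suc k) (x / L) / L ^ Suc k)
            (at x within {0<..L})" if "x \<in> {0<..L}" for k x
    proof -
      have "((\<lambda>x. x / L) has_real_derivative 1 / L) (at x within {0<..L})"
        using L by (auto intro!: derivative_eq_intros)
      moreover have "(D k has_real_derivative D (Suc k) (x / L))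
          (at (x / L) within (\<lambda>x. x / L) ` {0<..L})"
        using scale by (intro DERIV_subset[OF Dder[OF scale[OF that]]]) auto
      ultimately have "((D k \<circ> (\<lambda>x. x / L)) has_real_derivative D (Suc k) (x / L) * (1 / L))
          (at x within {0<..L})"
        by (rule DERIV_image_chain[rotated])
      from DERIV_cdivide[OF this, of "L ^ k"] show ?thesis by (simp add: o_def mult.commute)
    qed
    show "\<bar>D k (x / L) / L ^ k\<bar> \<le> c * L powr (- \<alpha>) * x powr (\<alpha> - real k)"
      if "x \<in> {0<..L}" "k \<ge> 1" for k x
    proof -
      have "\<bar>D k (x / L) / L ^ k\<bar> \<le> c * (x / L) powr (\<alpha> - real k) / L ^ k"
        using c(2)[OF scale[OF that(1)] that(2)] L by (simp add: abs_divide divide_right_mono)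
      also have "\<dots> = c * ((x / L) powr (\<alpha> - real k) / L ^ k)" by simp
      also have "(x / L) powr (\<alpha> - real k) / L ^ k = L powr (- \<alpha>) * x powr (\<alpha> - real k)"
        using that L by (simp add: powr_divide powr_diff powr_minus powr_realpow field_simps)
      finally show ?thesis by (simp only: mult.assoc)
    qed
  qed
qed

lemma node_choice_strict_mono:
  assumes "node_choice t" "0 < a" "a < b" "b \<le> 1" "1 \<le> m"
  shows "t a b m 0 = a" "t a b m m = b" "strict_mono_on {..m} (t a b m)"
    "\<And>j. j \<le> m \<Longrightarrow> t a b m j \<in> {a..b}"
proof -
  show t: "t a b m 0 = a" "t a b m m = b"
    and step: "strict_mono_on {..m} (t a b m)"
    using assms lift_Suc_mono_less_ivl[of "{..<m}" "t a b m"]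
    unfolding node_choice_def by (auto intro!: strict_mono_onI simp: subset_eq)
  show "t a b m j \<in> {a..b}" if "j \<le> m" for j
    using t that strict_mono_on_leD[OF step, of 0 j] strict_mono_on_leD[OF step, of j m] by simp
qed

section \<open>Uniform subdivision and counting of evaluation points\<close>

lemma subdiv_props:
  assumes "a < b" "N \<ge> 1"
  shows "subdiv a b N 0 = a" "subdiv a b N N = b"
    "subdiv a b N (Suc j) - subdiv a b N j = (b - a) / real N"
    "subdiv a b N j < subdiv a b N (Suc j)"
    "j \<le> N \<Longrightarrow> subdiv a b N j \<in> {a..b}"
proof -
  show "subdiv a b N 0 = a" "subdiv a b N N = b" using assms by (auto simp: subdiv_def)
  show d: "subdiv a b N (Suc j) - subdiv a b N j = (b - a) / real N"
    by (simp add: subdiv_def field_simps add_divide_distrib diff_divide_distrib)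
  have "(b - a) / real N > 0" using assms by simp
  then show "subdiv a b N j < subdiv a b N (Suc j)" using d by linarith
  show "subdiv a b N j \<in> {a..b}" if "j \<le> N"
  proof -
    have "(b - a) * (real j / real N) \<le> (b - a) * 1"
      using assms that by (intro mult_left_mono) auto
    then show ?thesis using assms by (simp add: subdiv_def)
  qed
qed

text \<open>Counting along a chain of pieces: the left endpoint of a piece is charged to its
  predecessor, so only the very first point is extra. Keeping \<open>p 0\<close> outside
  \<open>P\<close> lets the result be fed into itself, first for the cells of a mesh interval and
  then for the mesh intervals.\<close>

lemma chain_cover:
  fixes S :: "nat \<Rightarrow> 'a set" and p :: "nat \<Rightarrow> 'a"
  assumes "N \<ge> 1"
    and "\<And>j. j \<in> {1..N} \<Longrightarrow>
        \<exists>P. finite P \<and> card P \<le> c j \<and> S j \<subseteq> insert (p (j - 1)) P \<and> p j \<in> P"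
  shows "\<exists>P. finite P \<and> card P \<le> (\<Sum>j=1..N. c j) \<and> (\<Union>j\<in>{1..N}. S j) \<subseteq> insert (p 0) P \<and> p N \<in> P"
proof -
  obtain P where P: "\<And>j. j \<in> {1..N} \<Longrightarrow>
      finite (P j) \<and> card (P j) \<le> c j \<and> S j \<subseteq> insert (p (j - 1)) (P j) \<and> p j \<in> P j"
    using assms(2) by metis
  have "card (\<Union>j\<in>{1..N}. P j) \<le> (\<Sum>j=1..N. c j)"
    using P by (intro order_trans[OF card_UN_le] sum_mono) auto
  moreover have "(\<Union>j\<in>{1..N}. S j) \<subseteq> insert (p 0) (\<Union>j\<in>{1..N}. P j)"
  proof (rule UN_least)
    fix j assume j: "j \<in> {1..N}"
    have "p (j - 1) \<in> insert (p 0) (\<Union>j\<in>{1..N}. P j)"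
    proof (cases "j = 1")
      case False
      then have "j - 1 \<in> {1..N}" using j by auto
      then show ?thesis using P[of "j - 1"] by blast
    qed simp
    then show "S j \<subseteq> insert (p 0) (\<Union>j\<in>{1..N}. P j)" using P[OF j] j by blast
  qed
  moreover have "p N \<in> (\<Union>j\<in>{1..N}. P j)" using P[of N] assms(1) by auto
  ultimately show ?thesis using P by (intro exI[of _ "\<Union>j\<in>{1..N}. P j"]) auto
qed

lemma filon_uniform_points_cover:
  assumes t: "node_choice t" and ab: "0 < a" "a < b" "b \<le> 1" and m: "m \<ge> 1" and N: "N \<ge> 1"
  shows "\<exists>P. finite P \<and> card P \<le> N * m \<and> filon_uniform_points g t N m a b \<subseteq> insert (g a) P \<and> g b \<in> P"
proof -
  let ?y = "subdiv a b N"
  have "\<exists>P. finite P \<and> card P \<le> m \<and> filon_points g t m (?y (j - 1)) (?y j) \<subseteq> insert (g (?y (j - 1))) P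
          \<and> g (?y j) \<in> P" if j: "j \<in> {1..N}" for j
  proof -
    obtain i where i: "j = Suc i" using j by (cases j) auto
    note sub = subdiv_props[OF ab(2) N]
    have less: "0 < ?y i" "?y i < ?y j" "?y j \<le> 1"
      using sub(4)[of i] sub(5)[of i] sub(5)[of j] ab i j by auto
    note z = node_choice_strict_mono[OF t less m]
    \<comment> \<open>Of the \<open>m + 1\<close> nodes of a cell, the node of index 0 is its left
      endpoint, already counted elsewhere; this leaves \<open>m\<close>.\<close>
    have "{0..m} = insert 0 {1..m}" by auto
    then have "filon_points g t m (?y i) (?y j)
        = insert (g (?y i)) ((\<lambda>k. g (t (?y i) (?y j) m k)) ` {1..m})"
      using z by (simp add: filon_points_def)
    moreover have "g (?y j) \<in> (\<lambda>k. g (t (?y i) (?y j) m k)) ` {1..m}"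
      using z(2) m by (intro image_eqI[of _ _ m]) auto
    moreover have "card ((\<lambda>k. g (t (?y i) (?y j) m k)) ` {1..m}) \<le> m"
      using card_image_le[of "{1..m}"] by simp
    ultimately show ?thesis using i by (intro exI[of _ "(\<lambda>k. g (t (?y i) (?y j) m k)) ` {1..m}"]) simp
  qed
  from chain_cover[where c = "\<lambda>_. m" and p = "\<lambda>j. g (?y j)", OF N this]
  show ?thesis using subdiv_props[OF ab(2) N] by (simp add: filon_uniform_points_def)
qed

section \<open>The geometric mesh\<close>

lemma kappa_sigma_gt_1: "\<kappa> > 1 \<Longrightarrow> kappa_sigma \<sigma> \<kappa> > 1"
  by (simp add: kappa_sigma_def less_1_mult)

lemma mesh_props:
  assumes \<kappa>: "\<kappa> > 1" and n: "n \<ge> 1"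
  shows "mesh \<sigma> \<kappa> n 0 = lambda0 \<sigma> \<kappa>" "mesh \<sigma> \<kappa> n n = 1"
    "mesh \<sigma> \<kappa> n j > 0" "mesh \<sigma> \<kappa> n j < mesh \<sigma> \<kappa> n (Suc j)"
    "j \<le> n \<Longrightarrow> mesh \<sigma> \<kappa> n j \<le> 1"
    "mesh \<sigma> \<kappa> n (Suc j) = kappa_sigma \<sigma> \<kappa> powr (1 / real n) * mesh \<sigma> \<kappa> n j"
proof -
  let ?K = "kappa_sigma \<sigma> \<kappa>"
  have K: "?K > 1" using kappa_sigma_gt_1[OF \<kappa>] .
  show "mesh \<sigma> \<kappa> n 0 = lambda0 \<sigma> \<kappa>" using K by (simp add: mesh_def lambda0_def powr_minus)
  show "mesh \<sigma> \<kappa> n n = 1" using n K by (simp add: mesh_def)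
  show "mesh \<sigma> \<kappa> n j > 0" using K by (simp add: mesh_def)
  show "mesh \<sigma> \<kappa> n j < mesh \<sigma> \<kappa> n (Suc j)"
    using K n by (simp add: mesh_def divide_strict_right_mono)
  show "mesh \<sigma> \<kappa> n j \<le> 1" if "j \<le> n"
    using K n that powr_mono[of "real j / real n - 1" 0 ?K] by (simp add: mesh_def)
  show "mesh \<sigma> \<kappa> n (Suc j) = ?K powr (1 / real n) * mesh \<sigma> \<kappa> n j"
    using K by (simp add: mesh_def powr_add[symmetric] add_divide_distrib add_diff_eq)
qed

section \<open>Factorial estimates and an arithmetic sum\<close>

lemma fact_add_ge: "fact k * real k ^ s \<le> fact (k + s)"
proof (induction s)
  case (Suc s)
  have "fact k * real k ^ Suc s = real k * (fact k * real k ^ s)" by simp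
  also have "\<dots> \<le> real (Suc (k + s)) * fact (k + s)"
    using Suc.IH by (intro mult_mono) auto
  finally show ?case by simp
qed simp

text \<open>The singular growth \<open>r powr x\<close> is at most \<open>r ^ s\<close>; paired with
  the \<open>s\<close> surplus powers of \<open>r - 1\<close>, it is absorbed by the
  \<open>s\<close> surplus factors of the factorial, each at least \<open>n - 1\<close>.\<close>

lemma power_over_fact_bound:
  assumes r: "r > 1" and n: "n \<ge> 2" and cond: "r * (r - 1) \<le> (real n - 1) / exp 1"
    and x: "x \<le> real s"
  shows "r powr x * (r - 1) ^ (n + s) / fact (n + s - 1) \<le> (r - 1) ^ n / fact (n - 1)"
proof -
  obtain k where k: "n = Suc k" using n by (cases n) auto
  \<comment> \<open>Here \<open>k = n - 1\<close>, and the mesh condition is combined with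
    \<open>exp 1 \<ge> 1\<close>.\<close>
  have "r * (r - 1) \<le> real k"
  proof -
    have "real k / exp 1 \<le> real k / 1" by (intro divide_left_mono) auto
    then show ?thesis using cond k by simp
  qed
  then have p: "(r * (r - 1)) ^ s \<le> real k ^ s" using r by (intro power_mono) auto
  have "r powr x * (r - 1) ^ (n + s) \<le> r ^ s * (r - 1) ^ (n + s)"
    using r x powr_mono[of x "real s" r] by (intro mult_right_mono) (auto simp: powr_realpow)
  also have "\<dots> = (r - 1) ^ n * (r * (r - 1)) ^ s" by (simp add: power_add power_mult_distrib)
  also have "\<dots> \<le> (r - 1) ^ n * real k ^ s" using p r by (intro mult_left_mono) auto
  finally have "r powr x * (r - 1) ^ (n + s) * fact k \<le> (r - 1) ^ n * (fact k * real k ^ s)"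
    by (simp add: mult.assoc mult.left_commute mult_left_mono)
  also have "\<dots> \<le> (r - 1) ^ n * fact (k + s)"
    using r fact_add_ge[of k s] by (intro mult_left_mono) auto
  finally show ?thesis using k by (simp add: field_simps)
qed

text \<open>With \<open>k = i + 1\<close> and the factor \<open>i + 1\<close> removed, the claim is
  \<open>i + 2 \<le> 4 * fact i\<close>, which follows from \<open>fact i \<ge> i\<close> and
  \<open>fact i \<ge> 1\<close>. It later controls \<open>n / (n - 1)!\<close>.\<close>

lemma Suc_mult_le_fact: "(real k + 1) * real k \<le> 4 * fact k"
proof (cases k)
  case (Suc i)
  have "real i + 2 \<le> 4 * fact i"
    using fact_ge_self[of i] fact_ge_1[of i, where 'a = real]
    by (smt (verit) of_nat_fact of_nat_le_iff)
  then show ?thesis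
    using Suc mult_right_mono[of "real i + 2" "4 * fact i" "real i + 1"] by (simp add: algebra_simps)
qed simp

lemma sum_ramp: "(\<Sum>j=1..n. a + (real n + 1 - real j) * b) = real n * a + b * (real n ^ 2 + real n) / 2"
proof -
  have gauss: "(\<Sum>j=1..n. real j) = (real n ^ 2 + real n) / 2"
    by (induction n) (auto simp: power2_eq_square field_simps)
  have "(\<Sum>j=1..n. a + (real n + 1 - real j) * b) = (\<Sum>j=1..n. (a + (real n + 1) * b) - b * real j)"
    by (intro sum.cong) (auto simp: algebra_simps)
  also have "\<dots> = real n * (a + (real n + 1) * b) - b * (\<Sum>j=1..n. real j)"
    unfolding sum_subtractf sum_distrib_left by simp
  also have "\<dots> = real n * a + b * (real n ^ 2 + real n) / 2"
    unfolding gauss by (simp add: power2_eq_square field_simps)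
  finally show ?thesis .
qed

subsection \<open>The phase and the quadrature error\<close>

locale increasing_phase =
  fixes g g' :: "real \<Rightarrow> real" and \<sigma> \<delta> :: real
  assumes g_deriv: "\<And>x. x \<in> {0..1} \<Longrightarrow> (g has_real_derivative g' x) (at x within {0..1})"
    and g'_cont: "continuous_on {0..1} g'"
    and g_0: "g 0 = 0"
    and g'_nonzero: "\<And>x. x \<in> {0..1} \<Longrightarrow> g' x \<noteq> 0"
    and g_mono: "mono_on {0..1} g"
    and no_inflection: "mono_on {0..1} g' \<or> antimono_on {0..1} g'"
    and \<sigma>: "\<sigma> = (SUP x\<in>{0..1}. \<bar>g' x\<bar>)"
    and \<delta>: "\<delta> = (INF x\<in>{0..1}. \<bar>g' x\<bar>)"
begin

lemma mvt_phase:
  assumes "0 \<le> x" "x < y" "y \<le> 1"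
  shows "\<exists>\<xi>\<in>{x<..<y}. g y - g x = g' \<xi> * (y - x)"
proof -
  have "(g has_derivative (*) (g' z)) (at z within {x..y})" if "x \<le> z" "z \<le> y" for z
    using DERIV_subset[OF g_deriv, of z "{x..y}"] assms that by (auto simp: has_field_derivative_def)
  from mvt_simple[OF assms(2) this] show ?thesis by blast
qed

text \<open>Monotonicity gives a mean value point where \<open>g'\<close> is nonnegative; a
  nonpositive value anywhere else would then force a zero of the continuous
  \<open>g'\<close>.\<close>

lemma g'_pos:
  assumes "x \<in> {0..1}"
  shows "g' x > 0"
proof (rule ccontr)
  assume "\<not> g' x > 0"
  then have x: "g' x \<le> 0" by simp
  obtain \<xi> where \<xi>: "\<xi> \<in> {0<..<1}" "g 1 - g 0 = g' \<xi> * (1 - 0)"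
    using mvt_phase[of 0 1] by auto
  have "g 0 \<le> g 1" using g_mono by (auto simp: mono_on_def)
  then have "g' \<xi> \<ge> 0" using \<xi>(2) by simp
  moreover have "connected (g' ` {0..1})"
    using connected_continuous_image[OF g'_cont] by simp
  ultimately have "0 \<in> g' ` {0..1}"
    using connectedD_interval[of "g' ` {0..1}" "g' x" "g' \<xi>" 0] x assms \<xi>(1) by auto
  then show False using g'_nonzero by force
qed

text \<open>By compactness the supremum and infimum are attained, and positivity of
  \<open>g'\<close> removes the absolute values.\<close>

lemma slope_bounds:
  shows "\<delta> > 0" and "\<And>x. x \<in> {0..1} \<Longrightarrow> \<delta> \<le> g' x" "\<And>x. x \<in> {0..1} \<Longrightarrow> g' x \<le> \<sigma>"
proof -
  have "\<exists>a\<in>{0..1}. \<forall>x\<in>{0..1}. g' a \<le> g' x"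
    by (rule continuous_attains_inf) (simp_all add: g'_cont)
  then obtain a where a: "a \<in> {0..1}" "\<And>x. x \<in> {0..1} \<Longrightarrow> g' a \<le> g' x" by blast
  have "\<exists>b\<in>{0..1}. \<forall>x\<in>{0..1}. g' x \<le> g' b"
    by (rule continuous_attains_sup) (simp_all add: g'_cont)
  then obtain b where b: "b \<in> {0..1}" "\<And>x. x \<in> {0..1} \<Longrightarrow> g' x \<le> g' b" by blast
  have abs: "(\<lambda>x. \<bar>g' x\<bar>) ` {0..1} = g' ` {0..1}"
    by (intro image_cong) (use g'_pos in force)+
  have "(INF x\<in>{0..1}. g' x) = g' a"
    using a by (intro cInf_eq_minimum) auto
  moreover have "(SUP x\<in>{0..1}. g' x) = g' b"
    using b by (intro cSup_eq_maximum) auto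
  ultimately have "\<delta> = g' a" "\<sigma> = g' b"
    by (simp_all add: \<sigma> \<delta> abs)
  then show "\<delta> > 0" "\<And>x. x \<in> {0..1} \<Longrightarrow> \<delta> \<le> g' x" "\<And>x. x \<in> {0..1} \<Longrightarrow> g' x \<le> \<sigma>"
    using a b g'_pos by simp_all
qed

lemma \<sigma>_pos: "\<sigma> > 0"
  using slope_bounds(1) slope_bounds(2,3)[of 0] by simp

lemma increment_ge:
  assumes "0 \<le> x" "x \<le> y" "y \<le> 1"
  shows "\<delta> * (y - x) \<le> g y - g x"
proof (cases "x = y")
  case False
  then obtain \<xi> where "\<xi> \<in> {x<..<y}" "g y - g x = g' \<xi> * (y - x)"
    using mvt_phase[of x y] assms by auto
  then show ?thesis using slope_bounds(2)[of \<xi>] assms by (simp add: mult_right_mono)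
qed simp

lemma g_ge: "x \<in> {0..1} \<Longrightarrow> \<delta> * x \<le> g x"
  using increment_ge[of 0 x] g_0 by simp

lemma g_less:
  assumes "0 \<le> x" "x < y" "y \<le> 1"
  shows "g x < g y"
proof -
  have "0 < \<delta> * (y - x)" using slope_bounds(1) assms by simp
  then show ?thesis using increment_ge[of x y] assms by linarith
qed

lemma g_pos: "x \<in> {0<..1} \<Longrightarrow> g x > 0"
  using g_less[of 0 x] g_0 by simp

text \<open>This is where the absence of inflection points enters: a monotone \<open>g'\<close> is
  largest at an end of \<open>[a,b]\<close>, so sampling the slope at the two mesh points, as
  \<open>slope_max\<close> does, controls it in between.\<close>

lemma increment_le:
  assumes "0 \<le> a" "a \<le> x" "x < y" "y \<le> b" "b \<le> 1"
  shows "g y - g x \<le> max \<bar>g' a\<bar> \<bar>g' b\<bar> * (y - x)"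
proof -
  obtain \<xi> where \<xi>: "\<xi> \<in> {x<..<y}" "g y - g x = g' \<xi> * (y - x)"
    using mvt_phase[of x y] assms by auto
  have "g' \<xi> \<le> max (g' a) (g' b)"
    using no_inflection
  proof
    assume "mono_on {0..1} g'"
    then have "g' \<xi> \<le> g' b" using \<xi> assms by (auto elim!: mono_onD)
    then show ?thesis by simp
  next
    assume "antimono_on {0..1} g'"
    then have "g' \<xi> \<le> g' a" using \<xi> assms by (auto elim!: monotone_onD)
    then show ?thesis by simp
  qed
  also have "\<dots> \<le> max \<bar>g' a\<bar> \<bar>g' b\<bar>" by (auto simp: le_max_iff_disj)
  finally show ?thesis using \<xi>(2) assms by (simp add: mult_right_mono)
qed

lemma Psi_g:
  assumes "x \<in> {0..1}"
  shows "Psi f g g' (g x) = f x / g' x"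
proof -
  have "inj_on g {0..1}"
    by (intro linorder_inj_onI) (use g_less in fastforce)+
  then show ?thesis using assms by (simp add: Psi_def the_inv_into_f_f)
qed

lemma num_sub_bounds:
  assumes "\<kappa> > 1" "n \<ge> 1" "j \<in> {1..n}"
  shows "num_sub g g' \<sigma> \<kappa> n j \<ge> 1"
    and "real (num_sub g g' \<sigma> \<kappa> n j) \<le> of_int \<lceil>\<sigma> / \<delta>\<rceil>"
    and "slope_max g' \<sigma> \<kappa> n j * mesh \<sigma> \<kappa> n (j - 1) / g (mesh \<sigma> \<kappa> n (j - 1))
            \<le> real (num_sub g g' \<sigma> \<kappa> n j)"
proof -
  define x y where "x = mesh \<sigma> \<kappa> n (j - 1)" and "y = mesh \<sigma> \<kappa> n j"
  have x: "x \<in> {0<..1}" and y: "y \<in> {0<..1}"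
    using mesh_props(3,5)[OF assms(1,2), where \<sigma> = \<sigma>] assms(3) by (auto simp: x_def y_def)
  define M where "M = slope_max g' \<sigma> \<kappa> n j"
  have M: "0 < M" "M \<le> \<sigma>"
    using g'_pos[of x] g'_pos[of y] slope_bounds(3)[of x] slope_bounds(3)[of y] x y
    by (auto simp: M_def slope_max_def x_def y_def max_def)
  have q_pos: "M * x / g x > 0" using M(1) x g_pos[OF x] by simp
  \<comment> \<open>Both \<open>x\<close> and \<open>g x\<close> shrink towards the singularity, but
    their ratio is bounded through \<open>g x \<ge> \<delta> * x\<close>; the result is independent
    of \<open>j\<close>, \<open>n\<close> and \<open>\<kappa>\<close>.\<close>
  have "M * x / g x \<le> \<sigma> * x / (\<delta> * x)"
    using M x g_ge[of x] slope_bounds(1) \<sigma>_pos by (intro frac_le mult_right_mono) auto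
  then have q_le: "M * x / g x \<le> \<sigma> / \<delta>" using x by simp
  have N: "num_sub g g' \<sigma> \<kappa> n j = nat \<lceil>M * x / g x\<rceil>"
    by (simp add: num_sub_def M_def x_def)
  show "num_sub g g' \<sigma> \<kappa> n j \<ge> 1" using q_pos unfolding N by linarith
  show "real (num_sub g g' \<sigma> \<kappa> n j) \<le> of_int \<lceil>\<sigma> / \<delta>\<rceil>"
    using q_pos ceiling_mono[OF q_le] unfolding N by (simp add: of_nat_nat)
  show "slope_max g' \<sigma> \<kappa> n j * mesh \<sigma> \<kappa> n (j - 1) / g (mesh \<sigma> \<kappa> n (j - 1))
            \<le> real (num_sub g g' \<sigma> \<kappa> n j)"
    using q_pos unfolding N M_def[symmetric] x_def[symmetric] by (simp add: of_nat_nat)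
qed

lemma num_evals_le:
  assumes \<kappa>: "\<kappa> > 1" and n: "n \<ge> 1" and t: "node_choice t" and \<alpha>: "\<alpha> < 1"
  shows "real (num_evals g g' t \<alpha> \<sigma> \<kappa> n)
          \<le> of_int \<lceil>\<sigma> / \<delta>\<rceil> * (2 * real n ^ 2 + of_int \<lceil>1 - \<alpha>\<rceil> * (real n ^ 2 + real n)) / 2 + 1"
proof -
  let ?x = "mesh \<sigma> \<kappa> n" and ?N = "num_sub g g' \<sigma> \<kappa> n" and ?m = "interp_deg \<alpha> n"
  have "\<exists>P. finite P \<and> card P \<le> ?N j * ?m j \<and>
      filon_uniform_points g t (?N j) (?m j) (?x (j - 1)) (?x j) \<subseteq> insert (g (?x (j - 1))) P \<and>
      g (?x j) \<in> P" if "j \<in> {1..n}" for j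
  proof (rule filon_uniform_points_cover[OF t])
    show "0 < ?x (j - 1)" "?x (j - 1) < ?x j" "?x j \<le> 1"
      using mesh_props(3-5)[OF \<kappa> n, where \<sigma> = \<sigma>] that
        mesh_props(4)[OF \<kappa> n, where \<sigma> = \<sigma> and j = "j - 1"] by auto
    show "1 \<le> ?m j" using n by (simp add: interp_deg_def)
    show "1 \<le> ?N j" using num_sub_bounds(1)[OF \<kappa> n that] .
  qed
  \<comment> \<open>Second level of the counting: the pieces are now the mesh intervals, and the one
    leftover point \<open>g (?x 0)\<close> is the final \<open>+ 1\<close>.\<close>
  from chain_cover[where p = "\<lambda>j. g (?x j)" and c = "\<lambda>j. ?N j * ?m j", OF n this]
  obtain P where P: "finite P" "card P \<le> (\<Sum>j=1..n. ?N j * ?m j)"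
    "filon_composite_points g g' t \<alpha> \<sigma> \<kappa> n \<subseteq> insert (g (?x 0)) P"
    unfolding filon_composite_points_def by blast
  have "num_evals g g' t \<alpha> \<sigma> \<kappa> n \<le> card (insert (g (?x 0)) P)"
    unfolding num_evals_def using P by (intro card_mono) auto
  also have "\<dots> \<le> (\<Sum>j=1..n. ?N j * ?m j) + 1" using P(1,2) by (simp add: card_insert_if)
  finally have "real (num_evals g g' t \<alpha> \<sigma> \<kappa> n) \<le> real ((\<Sum>j=1..n. ?N j * ?m j) + 1)"
    by (simp only: of_nat_le_iff)
  then have "real (num_evals g g' t \<alpha> \<sigma> \<kappa> n) \<le> (\<Sum>j=1..n. real (?N j) * real (?m j)) + 1"
    by simp
  also have "(\<Sum>j=1..n. real (?N j) * real (?m j))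
      \<le> (\<Sum>j=1..n. of_int \<lceil>\<sigma> / \<delta>\<rceil> * (real n + (real n + 1 - real j) * of_int \<lceil>1 - \<alpha>\<rceil>))"
  proof (intro sum_mono mult_mono)
    fix j assume j: "j \<in> {1..n}"
    show "real (?N j) \<le> of_int \<lceil>\<sigma> / \<delta>\<rceil>" using num_sub_bounds(2)[OF \<kappa> n j] .
    have c: "(real n + 1 - real j) * (1 - \<alpha>) \<ge> 0" using j \<alpha> by simp
    \<comment> \<open>The right-hand side is an integer, so it also bounds the ceiling occurring in
      \<open>interp_deg\<close>.\<close>
    have "(real n + 1 - real j) * (1 - \<alpha>) \<le> (real n + 1 - real j) * of_int \<lceil>1 - \<alpha>\<rceil>"
      using j by (intro mult_left_mono) auto
    also have "\<dots> = of_int ((int n + 1 - int j) * \<lceil>1 - \<alpha>\<rceil>)" by simp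
    finally have "\<lceil>(real n + 1 - real j) * (1 - \<alpha>)\<rceil> \<le> (int n + 1 - int j) * \<lceil>1 - \<alpha>\<rceil>"
      by (simp only: ceiling_le_iff)
    then have "real_of_int \<lceil>(real n + 1 - real j) * (1 - \<alpha>)\<rceil>
        \<le> of_int ((int n + 1 - int j) * \<lceil>1 - \<alpha>\<rceil>)"
      by (simp only: of_int_le_iff)
    then show "real (?m j) \<le> real n + (real n + 1 - real j) * of_int \<lceil>1 - \<alpha>\<rceil>"
      using c by (simp add: interp_deg_def of_nat_nat)
    show "0 \<le> real_of_int \<lceil>\<sigma> / \<delta>\<rceil>"
      using divide_pos_pos[OF \<sigma>_pos slope_bounds(1)] le_of_int_ceiling[of "\<sigma> / \<delta>"] by linarith
  qed auto
  also have "\<dots> = of_int \<lceil>\<sigma> / \<delta>\<rceil> * (2 * real n ^ 2 + of_int \<lceil>1 - \<alpha>\<rceil> * (real n ^ 2 + real n)) / 2"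
    unfolding sum_distrib_left[symmetric] sum_ramp by (simp add: power2_eq_square field_simps)
  finally show ?thesis by simp
qed

end

section \<open>Error of the Filon rules on a cell, on a mesh interval and on the whole range\<close>

locale type_phase = increasing_phase +
  fixes f :: "real \<Rightarrow> real" and \<alpha> C :: real and D :: "nat \<Rightarrow> real \<Rightarrow> real"
  assumes f_cont: "continuous_on {0<..1} f"
    and \<alpha>: "\<alpha> < 1"
    and C: "C > 0"
    and D_0: "\<And>x. x \<in> {0<..g 1} \<Longrightarrow> D 0 x = Psi f g g' x"
    and D_deriv: "\<And>k x. x \<in> {0<..g 1} \<Longrightarrow> (D k has_real_derivative D (Suc k) x) (at x within {0<..g 1})"
    and D_bound: "\<And>k x. x \<in> {0<..g 1} \<Longrightarrow> k \<ge> 1 \<Longrightarrow> \<bar>D k x\<bar> \<le> C * x powr (\<alpha> - real k)"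
begin

abbreviation integrand :: "real \<Rightarrow> real \<Rightarrow> complex" where
  "integrand \<kappa> \<equiv> (\<lambda>x. complex_of_real (f x) * exp (\<i> * complex_of_real (\<kappa> * g x)))"

lemma g_cont: "continuous_on {0..1} g"
  by (rule DERIV_continuous_on[OF g_deriv])

lemma integrand_integrable:
  assumes "0 < a" "b \<le> 1"
  shows "integrand \<kappa> integrable_on {a..b}"
proof -
  have "continuous_on {a..b} f" "continuous_on {a..b} g"
    using assms by (auto intro: continuous_on_subset[OF f_cont] continuous_on_subset[OF g_cont])
  then show ?thesis by (intro integrable_continuous_real continuous_intros)
qed

text \<open>The division by \<open>g'\<close> in \<open>Psi\<close> cancels the Jacobian of
  \<open>y = g x\<close>, so the phase becomes linear and \<open>filon\<close> differs only by its
  interpolant.\<close>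

lemma integral_substitution_phase:
  assumes ab: "0 < a" "a < b" "b \<le> 1"
  shows "integral {a..b} (integrand \<kappa>)
    = integral {g a..g b} (\<lambda>y. complex_of_real (Psi f g g' y) * exp (\<i> * complex_of_real (\<kappa> * y)))"
proof -
  let ?h = "\<lambda>y. complex_of_real (Psi f g g' y) * exp (\<i> * complex_of_real (\<kappa> * y))"
  have img: "g x \<in> {g a..g b}" if "x \<in> {a..b}" for x
    using that ab mono_onD[OF g_mono, of a x] mono_onD[OF g_mono, of x b] by auto
  have sub: "{g a..g b} \<subseteq> {0<..g 1}"
    using g_pos[of a] mono_onD[OF g_mono, of b 1] ab by auto
  have "continuous_on {g a..g b} (D 0)"
    by (rule continuous_on_subset[OF DERIV_continuous_on[OF D_deriv] sub])
  then have "continuous_on {g a..g b} (Psi f g g')"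
    by (rule continuous_on_eq) (use sub D_0 in auto)
  then have "continuous_on {g a..g b} ?h" by (intro continuous_intros)
  moreover have "(g has_real_derivative g' x) (at x within {a..b})" if "x \<in> {a..b}" for x
    using that ab by (intro DERIV_subset[OF g_deriv]) auto
  ultimately have "((\<lambda>x. g' x *\<^sub>R ?h (g x)) has_integral integral {g a..g b} ?h) {a..b}"
    using img ab img[of b] by (intro has_integral_substitution[where c = "g a" and d = "g b"]) auto
  then have "integral {a..b} (\<lambda>x. g' x *\<^sub>R ?h (g x)) = integral {g a..g b} ?h"
    by (rule integral_unique)
  moreover have "integral {a..b} (\<lambda>x. g' x *\<^sub>R ?h (g x)) = integral {a..b} (integrand \<kappa>)"
  proof (rule integral_cong)
    fix x assume "x \<in> {a..b}"
    then have x: "x \<in> {0..1}" using ab by auto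
    show "g' x *\<^sub>R ?h (g x) = integrand \<kappa> x"
      using g'_nonzero[OF x] by (simp add: Psi_g[OF x] scaleR_conv_of_real)
  qed
  ultimately show ?thesis by simp
qed

text \<open>\<open>G\<close> stands for the value of \<open>g\<close> at the left end of the
  surrounding mesh interval. Measuring the singularity and the image length against
  \<open>G\<close>, not \<open>g a\<close>, yields one bound for all cells of that interval.\<close>

lemma filon_error:
  assumes \<kappa>: "\<kappa> > 0" and t: "node_choice t" and m: "m \<ge> 1"
    and ab: "0 < a" "a < b" "b \<le> 1"
    and G: "0 < G" "G \<le> g a" and r: "g b - g a \<le> G * r"
  shows "cmod (integral {a..b} (integrand \<kappa>) - filon f g g' t \<kappa> m a b)
          \<le> 3 * C * G powr (\<alpha> - 1) * r ^ m / fact (m - 1) / \<kappa>\<^sup>2"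
proof -
  note z = node_choice_strict_mono[OF t ab m]
  have sub: "{g a..g b} \<subseteq> {0<..g 1}"
    using g_pos[of a] mono_onD[OF g_mono, of b 1] ab by auto
  have gab: "g a < g b" using g_less[of a b] ab by simp
  define B where "B = C * G powr (\<alpha> - real (Suc m))"
  have "cmod (integral {g a..g b} (\<lambda>x. complex_of_real (Psi f g g' x) * exp (\<i> * complex_of_real (\<kappa> * x)))
      - filon f g g' t \<kappa> m a b) \<le> 3 * B * (g b - g a) ^ m / fact (m - 1) / \<kappa>\<^sup>2"
    unfolding filon_def
  proof (rule interpolation_integral_error[where D = D])
    show "(D k has_real_derivative D (Suc k) x) (at x within {g a..g b})" if "x \<in> {g a..g b}" for k x
      using that sub by (intro DERIV_subset[OF D_deriv sub]) auto
    show "strict_mono_on {..m} (\<lambda>j. g (t a b m j))"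
    proof (rule strict_mono_onI)
      fix i j assume ij: "i \<in> {..m}" "j \<in> {..m}" "i < j"
      then show "g (t a b m i) < g (t a b m j)"
        using z(4)[of i] z(4)[of j] strict_mono_onD[OF z(3) ij] ab by (intro g_less) auto
    qed
    show "\<bar>D (Suc m) x\<bar> \<le> B" if x: "x \<in> {g a..g b}" for x
    proof -
      have "\<bar>D (Suc m) x\<bar> \<le> C * x powr (\<alpha> - real (Suc m))" using D_bound[of x "Suc m"] x sub by auto
      \<comment> \<open>The exponent is negative because \<open>\<alpha> < 1\<close>, and
        \<open>x \<ge> g a \<ge> G\<close>.\<close>
      also have "\<dots> \<le> B"
        unfolding B_def using C G x \<alpha> by (intro mult_left_mono powr_mono2') auto
      finally show ?thesis .
    qed
  qed (use \<kappa> m z D_0 sub in auto)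
  also have "\<dots> \<le> 3 * B * (G * r) ^ m / fact (m - 1) / \<kappa>\<^sup>2"
    using C r gab by (intro divide_right_mono mult_left_mono power_mono) (auto simp: B_def)
  also have "\<dots> = 3 * (B * G ^ m) * r ^ m / fact (m - 1) / \<kappa>\<^sup>2"
    by (simp add: power_mult_distrib)
  \<comment> \<open>The exponents add up to \<open>\<alpha> - (m + 1) + m = \<alpha> - 1\<close>,
    free of \<open>m\<close>.\<close>
  also have "B * G ^ m = C * G powr (\<alpha> - 1)"
    using G by (simp add: B_def powr_realpow[symmetric] powr_add[symmetric])
  finally show ?thesis using integral_substitution_phase[OF ab] by (simp add: mult.assoc)
qed

lemma filon_uniform_error:
  assumes \<kappa>: "\<kappa> > 0" and t: "node_choice t" and m: "m \<ge> 1"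
    and ab: "0 < a" "a < b" "b \<le> 1"
    and N: "N \<ge> 1" "max \<bar>g' a\<bar> \<bar>g' b\<bar> * a / g a \<le> real N"
  shows "cmod (integral {a..b} (integrand \<kappa>) - filon_uniform f g g' t N \<kappa> m a b)
          \<le> real N * (3 * C * g a powr (\<alpha> - 1) * (b / a - 1) ^ m / fact (m - 1) / \<kappa>\<^sup>2)"
proof -
  let ?y = "subdiv a b N"
  note y = subdiv_props[OF ab(2) N(1)]
  have ga: "g a > 0" using g_pos ab by simp
  have "integral {a..b} (integrand \<kappa>) = (\<Sum>j=1..N. integral {?y (j - 1)..?y j} (integrand \<kappa>))"
    using integral_split_sum[of N ?y "integrand \<kappa>"] y(1,2) less_imp_le[OF y(4)]
      integrand_integrable[OF ab(1,3)] by simp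
  then have "cmod (integral {a..b} (integrand \<kappa>) - filon_uniform f g g' t N \<kappa> m a b)
     \<le> (\<Sum>j=1..N. cmod (integral {?y (j - 1)..?y j} (integrand \<kappa>) - filon f g g' t \<kappa> m (?y (j - 1)) (?y j)))"
    by (simp add: filon_uniform_def sum_subtractf[symmetric] norm_sum)
  also have "\<dots> \<le> (\<Sum>j=1..N. 3 * C * g a powr (\<alpha> - 1) * (b / a - 1) ^ m / fact (m - 1) / \<kappa>\<^sup>2)"
  proof (intro sum_mono filon_error[OF \<kappa> t m])
    fix j assume j: "j \<in> {1..N}"
    then have in_ab: "?y (j - 1) \<in> {a..b}" "?y j \<in> {a..b}"
      using y(5)[of j] y(5)[of "j - 1"] by auto
    then show "0 < ?y (j - 1)" "?y j \<le> 1" using ab by auto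
    show less: "?y (j - 1) < ?y j" using y(4)[of "j - 1"] j by simp
    show "0 < g a" by fact
    show "g a \<le> g (?y (j - 1))" using in_ab ab by (intro mono_onD[OF g_mono]) auto
    have "g (?y j) - g (?y (j - 1)) \<le> max \<bar>g' a\<bar> \<bar>g' b\<bar> * (?y j - ?y (j - 1))"
      using in_ab less ab by (intro increment_le) auto
    also have "?y j - ?y (j - 1) = (b - a) / real N" using y(3)[of "j - 1"] j by simp
    \<comment> \<open>After clearing denominators this is the assumed lower bound on
      \<open>N\<close> multiplied by \<open>b - a\<close>.\<close>
    also have "max \<bar>g' a\<bar> \<bar>g' b\<bar> * ((b - a) / real N) \<le> g a * (b / a - 1)"
    proof -
      have "max \<bar>g' a\<bar> \<bar>g' b\<bar> * a \<le> real N * g a" using N(2) ga by (simp add: pos_divide_le_eq)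
      then have "(max \<bar>g' a\<bar> \<bar>g' b\<bar> * a) * (b - a) \<le> (real N * g a) * (b - a)"
        using ab by (intro mult_right_mono) auto
      then show ?thesis using ab N(1) by (simp add: field_simps)
    qed
    finally show "g (?y j) - g (?y (j - 1)) \<le> g a * (b / a - 1)" .
  qed
  finally show ?thesis by simp
qed

lemma filon_composite_error:
  assumes \<kappa>: "\<kappa> > 1" and n: "n \<ge> 1" and t: "node_choice t"
    and r: "r = kappa_sigma \<sigma> \<kappa> powr (1 / real n)"
    and cond: "r * (r - 1) \<le> (real n - 1) / exp 1"
  shows "cmod (osc_integral f g \<sigma> \<kappa> - filon_composite f g g' t \<alpha> \<sigma> \<kappa> n)
          \<le> 12 * C * \<delta> powr (\<alpha> - 1) * of_int \<lceil>\<sigma> / \<delta>\<rceil> * (real n - 1) powr (- 1 / 2)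
              * \<kappa> powr (- 2) * (r - 1) ^ n"
proof -
  let ?x = "mesh \<sigma> \<kappa> n" and ?N = "num_sub g g' \<sigma> \<kappa> n" and ?m = "interp_deg \<alpha> n"
  let ?K = "kappa_sigma \<sigma> \<kappa>" and ?A = "real_of_int \<lceil>\<sigma> / \<delta>\<rceil>"
  have K: "?K > 1" using kappa_sigma_gt_1[OF \<kappa>] .
  have r1: "r > 1" using K n by (simp add: r)
  \<comment> \<open>For \<open>n = 1\<close> the right-hand side of the mesh condition is 0 while
    the left-hand side is positive.\<close>
  have "n \<noteq> 1"
  proof
    assume "n = 1"
    moreover have "r * (r - 1) > 0" using r1 by simp
    ultimately show False using cond by simp
  qed
  then have n2: "n \<ge> 2" using n by simp
  note x = mesh_props[OF \<kappa> n, where \<sigma> = \<sigma>]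
  have A: "?A \<ge> 0"
    using divide_pos_pos[OF \<sigma>_pos slope_bounds(1)] le_of_int_ceiling[of "\<sigma> / \<delta>"] by linarith
  have "osc_integral f g \<sigma> \<kappa> = (\<Sum>j=1..n. integral {?x (j - 1)..?x j} (integrand \<kappa>))"
    using integral_split_sum[of n ?x "integrand \<kappa>", OF less_imp_le[OF x(4)]] x(1,2) x(3)[of 0]
      integrand_integrable[of "?x 0" 1 \<kappa>] by (simp add: osc_integral_def)
  then have "cmod (osc_integral f g \<sigma> \<kappa> - filon_composite f g g' t \<alpha> \<sigma> \<kappa> n)
     \<le> (\<Sum>j=1..n. cmod (integral {?x (j - 1)..?x j} (integrand \<kappa>)
          - filon_uniform f g g' t (?N j) \<kappa> (?m j) (?x (j - 1)) (?x j)))"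
    by (simp add: filon_composite_def sum_subtractf[symmetric] norm_sum)
  also have "\<dots> \<le> (\<Sum>j=1..n. 3 * C * \<delta> powr (\<alpha> - 1) * ?A * ((r - 1) ^ n / fact (n - 1)) / \<kappa>\<^sup>2)"
  proof (rule sum_mono)
    fix j assume j: "j \<in> {1..n}"
    define a b where "a = ?x (j - 1)" and "b = ?x j"
    have b: "b = r * a" using x(6)[of "j - 1"] j by (simp add: a_def b_def r)
    have ab: "0 < a" "a < b" "b \<le> 1"
      using x(3-5)[of j] x(3)[of "j - 1"] x(4)[of "j - 1"] j by (auto simp: a_def b_def)
    have br: "b / a = r" using b ab by simp
    define s where "s = nat \<lceil>(real n + 1 - real j) * (1 - \<alpha>)\<rceil>"
    have m: "?m j = n + s" by (simp add: interp_deg_def s_def)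
    have s: "(real n + 1 - real j) * (1 - \<alpha>) \<le> real s" unfolding s_def by (rule real_nat_ceiling_ge)
    \<comment> \<open>The left mesh point is \<open>r powr (j - 1 - n)\<close>. The resulting
      exponent is exactly the quantity rounded up in \<open>interp_deg\<close>, so it is at most
      \<open>s\<close>.\<close>
    have a_powr: "a powr (\<alpha> - 1) = r powr ((real n + 1 - real j) * (1 - \<alpha>))"
    proof -
      have "(real (j - 1) / real n - 1) * (\<alpha> - 1) = 1 / real n * ((real n + 1 - real j) * (1 - \<alpha>))"
        using j by (simp add: of_nat_diff field_simps)
      then show ?thesis by (simp add: a_def mesh_def r powr_powr)
    qed
    have ga: "g a powr (\<alpha> - 1) \<le> \<delta> powr (\<alpha> - 1) * a powr (\<alpha> - 1)"
    proof -
      have "g a powr (\<alpha> - 1) \<le> (\<delta> * a) powr (\<alpha> - 1)"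
        using \<alpha> ab slope_bounds(1) g_ge[of a] by (intro powr_mono2') auto
      then show ?thesis using slope_bounds(1) ab by (simp add: powr_mult)
    qed
    note N = num_sub_bounds[OF \<kappa> n j]
    have "cmod (integral {a..b} (integrand \<kappa>) - filon_uniform f g g' t (?N j) \<kappa> (?m j) a b)
      \<le> real (?N j) * (3 * C * g a powr (\<alpha> - 1) * (b / a - 1) ^ ?m j / fact (?m j - 1) / \<kappa>\<^sup>2)"
      using \<kappa> n N t ab by (intro filon_uniform_error) (auto simp: m slope_max_def a_def b_def)
    also have "\<dots> \<le> ?A * (3 * C * (\<delta> powr (\<alpha> - 1) * a powr (\<alpha> - 1)) * (r - 1) ^ (n + s)
        / fact (n + s - 1) / \<kappa>\<^sup>2)"
      unfolding br m using N(2) A C ga r1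
      by (intro mult_mono divide_right_mono mult_right_mono mult_left_mono) auto
    also have "\<dots> = 3 * C * \<delta> powr (\<alpha> - 1) * ?A / \<kappa>\<^sup>2
        * (r powr ((real n + 1 - real j) * (1 - \<alpha>)) * (r - 1) ^ (n + s) / fact (n + s - 1))"
      by (simp add: a_powr mult_ac)
    also have "\<dots> \<le> 3 * C * \<delta> powr (\<alpha> - 1) * ?A / \<kappa>\<^sup>2 * ((r - 1) ^ n / fact (n - 1))"
      using C A by (intro mult_left_mono power_over_fact_bound[OF r1 n2 cond s]) auto
    finally show "cmod (integral {?x (j - 1)..?x j} (integrand \<kappa>)
          - filon_uniform f g g' t (?N j) \<kappa> (?m j) (?x (j - 1)) (?x j))
        \<le> 3 * C * \<delta> powr (\<alpha> - 1) * ?A * ((r - 1) ^ n / fact (n - 1)) / \<kappa>\<^sup>2"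
      by (simp add: a_def b_def mult.commute[of "\<kappa>\<^sup>2"])
  qed
  \<comment> \<open>The bound no longer depends on \<open>j\<close>, so the summation contributes a
    factor \<open>n\<close>.\<close>
  also have "\<dots> = 3 * C * \<delta> powr (\<alpha> - 1) * ?A * (r - 1) ^ n / \<kappa>\<^sup>2 * (real n / fact (n - 1))"
    by (simp add: mult_ac)
  also have "\<dots> \<le> 3 * C * \<delta> powr (\<alpha> - 1) * ?A * (r - 1) ^ n / \<kappa>\<^sup>2 * (4 * (real n - 1) powr (- 1 / 2))"
  proof (intro mult_left_mono)
    obtain k where k: "n = Suc k" "k \<ge> 1" using n2 by (cases n) auto
    \<comment> \<open>The decay \<open>(n - 1) powr (- 1 / 2)\<close> comes from multiplying
      \<open>(k + 1) / fact k\<close> by \<open>sqrt k \<le> k\<close>; the 4 from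
      \<open>Suc_mult_le_fact\<close> turns 3 into 12.\<close>
    have "sqrt (real k) \<le> real k"
      using k real_sqrt_le_mono[of "real k" "real k * real k"] by simp
    then have "(real k + 1) * sqrt (real k) \<le> (real k + 1) * real k"
      by (intro mult_left_mono) auto
    also have "\<dots> \<le> 4 * fact k" by (rule Suc_mult_le_fact)
    finally have "(real k + 1) / fact k \<le> 4 / sqrt (real k)" using k by (simp add: field_simps)
    moreover have nk: "real n = real k + 1" "real n - 1 = real k" "n - 1 = k" using k by simp_all
    moreover have "real k powr (- 1 / 2) = 1 / sqrt (real k)"
      using powr_minus_divide[of "real k" "1 / 2"] powr_half_sqrt[of "real k"] by simp
    ultimately show "real n / fact (n - 1) \<le> 4 * (real n - 1) powr (- 1 / 2)"
      unfolding nk by simp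
    show "0 \<le> 3 * C * \<delta> powr (\<alpha> - 1) * ?A * (r - 1) ^ n / \<kappa>\<^sup>2" using C A r1 by simp
  qed
  also have "\<dots> = 12 * C * \<delta> powr (\<alpha> - 1) * ?A * (real n - 1) powr (- 1 / 2)
              * \<kappa> powr (- 2) * (r - 1) ^ n"
  proof -
    have "\<kappa> powr (- 2) = 1 / \<kappa>\<^sup>2" using \<kappa> by (simp add: powr_minus_divide)
    then show ?thesis by (simp add: mult_ac)
  qed
  finally show ?thesis .
qed

end

section \<open>Assembling the final estimate\<close>

text \<open>Distributing \<open>kappa_sigma\<close> as an \<open>n\<close>-th power over the factors
  uses \<open>r * (1 - 1 / r) = r - 1\<close>; this converts the error bound in \<open>r\<close>
  into the form with \<open>rho0\<close>.\<close>

lemma kappa_sigma_rho0_power: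
  assumes "\<kappa> > 1" "n \<ge> 1"
  shows "kappa_sigma \<sigma> \<kappa> * rho0 \<sigma> \<kappa> n ^ n = (kappa_sigma \<sigma> \<kappa> powr (1 / real n) - 1) ^ n"
proof -
  let ?K = "kappa_sigma \<sigma> \<kappa>"
  have K: "?K > 1" using kappa_sigma_gt_1[OF assms(1)] .
  have "?K = (?K powr (1 / real n)) ^ n"
    using K assms(2) by (simp add: powr_realpow[symmetric] powr_powr)
  then have "?K * rho0 \<sigma> \<kappa> n ^ n = (?K powr (1 / real n) * rho0 \<sigma> \<kappa> n) ^ n"
    by (simp add: power_mult_distrib)
  also have "?K powr (1 / real n) * rho0 \<sigma> \<kappa> n = ?K powr (1 / real n) - 1"
    using K by (simp add: rho0_def lambda0_def right_diff_distrib powr_mult[symmetric])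
  finally show ?thesis .
qed

theorem theorem5p10:
  fixes f g g' :: "real \<Rightarrow> real" and \<alpha> \<sigma>0 \<delta>0 :: real
  assumes g_deriv: "\<And>x. x \<in> {0..1} \<Longrightarrow> (g has_real_derivative g' x) (at x within {0..1})"
    and g'_cont: "continuous_on {0..1} g'"
    and g_0: "g 0 = 0"
    and g'_nonzero: "\<And>x. x \<in> {0..1} \<Longrightarrow> g' x \<noteq> 0"
    and g_mono: "mono_on {0..1} g"
    and no_inflection: "mono_on {0..1} g' \<or> antimono_on {0..1} g'"
    and \<sigma>0: "\<sigma>0 = (SUP x\<in>{0..1}. \<bar>g' x\<bar>)"
    and \<delta>0: "\<delta>0 = (INF x\<in>{0..1}. \<bar>g' x\<bar>)"
    and f_L1: "set_integrable lebesgue {0..1} f"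
    and f_cont: "continuous_on {0<..1} f"
    and \<alpha>: "-1 < \<alpha>" "\<alpha> < 1"
    and \<Theta>_type: "type_infinity \<alpha> (\<lambda>y. Psi f g g' (g 1 * y))"
  shows
    "(\<exists>c>0. \<forall>\<kappa>>1. \<forall>n\<ge>1. \<forall>t. node_choice t \<longrightarrow>
        kappa_sigma \<sigma>0 \<kappa> powr (1 / real n) * (kappa_sigma \<sigma>0 \<kappa> powr (1 / real n) - 1)
          \<le> (real n - 1) / exp 1 \<longrightarrow>
        cmod (osc_integral f g \<sigma>0 \<kappa> - filon_composite f g g' t \<alpha> \<sigma>0 \<kappa> n)
          \<le> c * \<bar>g 1\<bar> powr (- \<alpha>) * \<sigma>0 * \<delta>0 powr (\<alpha> - 2) * (real n - 1) powr (- 1 / 2)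
              * \<kappa> powr (- 2) * kappa_sigma \<sigma>0 \<kappa> * rho0 \<sigma>0 \<kappa> n ^ n) \<and>
     (\<forall>\<kappa>>1. \<forall>n\<ge>1. \<forall>t. node_choice t \<longrightarrow>
        real (num_evals g g' t \<alpha> \<sigma>0 \<kappa> n)
          \<le> of_int \<lceil>\<sigma>0 / \<delta>0\<rceil>
              * (2 * real n ^ 2 + of_int \<lceil>1 - \<alpha>\<rceil> * (real n ^ 2 + real n)) / 2 + 1)"
proof -
  interpret increasing_phase g g' \<sigma>0 \<delta>0
    by unfold_locales (fact assms)+
  have g1: "g 1 > 0" by (simp add: g_pos)
  obtain D C where DC: "type_phase g g' \<sigma>0 \<delta>0 f \<alpha> C D"
    using type_infinity_rescale[OF \<Theta>_type g1] f_cont \<alpha>(2) increasing_phase_axioms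
    by (metis type_phase.intro type_phase_axioms.intro)
  then interpret type_phase g g' \<sigma>0 \<delta>0 f \<alpha> C D .
  \<comment> \<open>\<open>A\<close> collects the constants of \<open>filon_composite_error\<close>,
    and \<open>P\<close> the factors displayed in the claim. Both depend only on \<open>f\<close>,
    \<open>g\<close> and \<open>\<alpha>\<close>, so the witness \<open>A / P\<close> is uniform in
    \<open>\<kappa>\<close>, \<open>n\<close> and the nodes.\<close>
  define A where "A = 12 * C * \<delta>0 powr (\<alpha> - 1) * of_int \<lceil>\<sigma>0 / \<delta>0\<rceil>"
  define P where "P = \<bar>g 1\<bar> powr (- \<alpha>) * \<sigma>0 * \<delta>0 powr (\<alpha> - 2)"
  have P: "P > 0" using g1 \<sigma>_pos slope_bounds(1) by (simp add: P_def)
  have "\<sigma>0 / \<delta>0 > 0" using \<sigma>_pos slope_bounds(1) by simp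
  then have A: "A > 0" using C slope_bounds(1) by (simp add: A_def)
  have "cmod (osc_integral f g \<sigma>0 \<kappa> - filon_composite f g g' t \<alpha> \<sigma>0 \<kappa> n)
          \<le> A / P * \<bar>g 1\<bar> powr (- \<alpha>) * \<sigma>0 * \<delta>0 powr (\<alpha> - 2) * (real n - 1) powr (- 1 / 2)
              * \<kappa> powr (- 2) * kappa_sigma \<sigma>0 \<kappa> * rho0 \<sigma>0 \<kappa> n ^ n"
    if "\<kappa> > 1" "n \<ge> 1" "node_choice t"
      "kappa_sigma \<sigma>0 \<kappa> powr (1 / real n) * (kappa_sigma \<sigma>0 \<kappa> powr (1 / real n) - 1)
          \<le> (real n - 1) / exp 1" for \<kappa> n t
  proof -
    have "cmod (osc_integral f g \<sigma>0 \<kappa> - filon_composite f g g' t \<alpha> \<sigma>0 \<kappa> n)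
        \<le> A * (real n - 1) powr (- 1 / 2) * \<kappa> powr (- 2)
            * (kappa_sigma \<sigma>0 \<kappa> * rho0 \<sigma>0 \<kappa> n ^ n)"
      using filon_composite_error[OF that(1-3) refl that(4)]
      unfolding A_def kappa_sigma_rho0_power[OF that(1,2)] .
    also have "A = A / P * (\<bar>g 1\<bar> powr (- \<alpha>) * \<sigma>0 * \<delta>0 powr (\<alpha> - 2))"
      unfolding P_def[symmetric] using P by simp
    finally show ?thesis by (simp only: mult.assoc)
  qed
  then show ?thesis
    using A P num_evals_le \<open>\<alpha> < 1\<close> by (intro conjI exI[of _ "A / P"]) auto
qed

end
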